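(* Fix an integer $m\ge 1$. For each $n\ge 1$ let $\pi$ be uniformly distributed on $S_n\wr S_m\subset S_{nm}$, or let $\pi$ be uniformly distributed on $S_m\otimes S_n\subset S_{nm}$, and set $h_{n,m}=h(\mathcal T(\pi))$. Then, in either case, $h_{n,m}/\log(nm)$ converges in distribution to $c^*+h_m$ as $n\to\infty$, where $c^*\approx 4.311$ is the unique solution of $x\log(2e/x)=1$ with $x\ge 2$, and $h_m$ denotes the random height $h(\mathcal T(\rho))$ of the binary search tree of a uniformly random permutation $\rho\in S_m$.
   Context: For a sequence $x=(x_1,\dots,x_k)$ of distinct real numbers (in particular for a permutation written in one-line notation $\pi(1)\pi(2)\cdots\pi(k)$), $\mathcal T(x)$ is the binary search tree obtained by inserting the keys $x_1,x_2,\dots,x_k$ in this order into the initially empty tree (smaller keys go to the left subtree, larger keys to the right subtree). The depth of a node is the number of edges on the path from the root to it, and the height $h(\mathcal T(x))$ is the maximal depth of a node. $\log$ is the natural logarithm. For $\pi\in S_n$ let $P_\pi$ be the permutation matrix with $P_\pi e_i=e_{\pi(i)}$. For $\rho\in S_m$, $\pi\in S_n$, $\rho\otimes\pi\in S_{nm}$ is the permutation with matrix $P_\rho\otimes P_\pi$ (Kronecker product, i.e. each entry $(P_\rho)_{ij}$ is replaced by the block $(P_\rho)_{ij}P_\pi$), and $S_m\otimes S_n=\{\rho\otimes\pi:\rho\in S_m,\pi\in S_n\}$. The wreath product $S_n\wr S_m\subset S_{nm}$ is realized as the set of permutations with matrix $\big(\bigoplus_{j=1}^m P_{\pi_j}\big)(P_\rho\otimes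 I_n)$, where $\pi_1,\dots,\pi_m\in S_n$, $\rho\in S_m$, $\bigoplus$ denotes block-diagonal sum and $I_n$ is the identity matrix. *)

theory Defs
  imports
    "HOL-Probability.Probability"
    "HOL-Combinatorics.Permutations"
    "HOL-Library.Tree"
    "Jordan_Normal_Form.Matrix"
begin

subsection \<open>Binary search trees\<close>

(* Only distinct keys are ever inserted, so the treatment of a key that is already present is
   irrelevant. *)
fun bst_insert :: "'a::linorder \<Rightarrow> 'a tree \<Rightarrow> 'a tree" where
  "bst_insert x Leaf = Node Leaf x Leaf"
| "bst_insert x (Node l a r) =
     (if x < a then Node (bst_insert x l) a r
      else if a < x then Node l a (bst_insert x r)
      else Node l a r)"

definition bst_of_list :: "'a::linorder list \<Rightarrow> 'a tree" where
  "bst_of_list xs = fold bst_insert xs Leaf"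

(* The nodes of a tree are its Node constructors; Leaf stands for an empty subtree and does not
   count as a node.  Depths are counted in edges, the root having depth 0. *)
fun node_depths :: "'a tree \<Rightarrow> nat set" where
  "node_depths Leaf = {}"
| "node_depths (Node l a r) = insert 0 (Suc ` (node_depths l \<union> node_depths r))"

(* The library function height counts nodes instead of edges on a longest path, hence differs
   by one; see the lemma edge_height_eq_height below. *)
definition edge_height :: "'a tree \<Rightarrow> nat" where
  "edge_height t = Max (node_depths t)"

lemma finite_node_depths [simp]: "finite (node_depths t)"
  by (induction t) auto

lemma node_depths_eq: "node_depths t = {..<height t}"
proof (induction t)
  case (Node l a r)
  have "node_depths l \<union> node_depths r = {..<max (height l) (height r)}"
    using Node by auto
  then show ?case
    by (auto simp: lessThan_Suc_eq_insert_0)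
qed auto

lemma edge_height_eq_height:
  assumes "t \<noteq> Leaf"
  shows "edge_height t = height t - 1"
proof -
  have "{..<height t} = {..height t - 1}"
    using assms by (cases t) auto
  then show ?thesis
    by (auto simp: edge_height_def node_depths_eq intro!: Max_eqI)
qed

(* Elements of the symmetric group on k letters are represented as functions p with
   p permutes {..<k}, i.e. letters are numbered from 0.  The one-line notation is
   p 0, ..., p (k - 1). *)
definition bst_height :: "nat \<Rightarrow> (nat \<Rightarrow> nat) \<Rightarrow> nat" where
  "bst_height k p = edge_height (bst_of_list (map p [0..<k]))"


subsection \<open>Permutation matrices, tensor and wreath products\<close>

definition perm_mat :: "nat \<Rightarrow> (nat \<Rightarrow> nat) \<Rightarrow> real mat" where
  "perm_mat n p = Matrix.mat n n (\<lambda>(i, j). if i = p j then 1 else 0)"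

lemma perm_mat_mult_unit_vec:
  assumes "p permutes {..<n}" "i < n"
  shows "perm_mat n p *\<^sub>v unit_vec n i = unit_vec n (p i)"
proof (rule eq_vecI)
  fix k assume k: "k < dim_vec (unit_vec n (p i) :: real Matrix.vec)"
  have "vec_index (perm_mat n p *\<^sub>v unit_vec n i) k =
      (\<Sum>j = 0..<n. (if k = p j then 1 else 0) * (if j = i then 1 else 0))"
    using k assms(2) by (auto simp: perm_mat_def scalar_prod_def unit_vec_def intro!: sum.cong)
  also have "\<dots> = (\<Sum>j = 0..<n. if j = i then (if k = p j then 1 else 0) else 0)"
    by (rule sum.cong) auto
  also have "\<dots> = (if k = p i then 1 else 0)"
    using assms(2) by simp
  finally show "vec_index (perm_mat n p *\<^sub>v unit_vec n i) k = vec_index (unit_vec n (p i)) k"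
    using k by (simp add: unit_vec_def)
qed (simp add: perm_mat_def)

definition kronecker :: "'a::times mat \<Rightarrow> 'a mat \<Rightarrow> 'a mat" where
  "kronecker A B = Matrix.mat (dim_row A * dim_row B) (dim_col A * dim_col B)
     (\<lambda>(i, j). A $$ (i div dim_row B, j div dim_col B) * B $$ (i mod dim_row B, j mod dim_col B))"

definition tensor_perms :: "nat \<Rightarrow> nat \<Rightarrow> (nat \<Rightarrow> nat) set" where
  "tensor_perms m n = {\<sigma>. \<sigma> permutes {..<n * m} \<and>
     (\<exists>\<rho> \<pi>. \<rho> permutes {..<m} \<and> \<pi> permutes {..<n} \<and>
        perm_mat (n * m) \<sigma> = kronecker (perm_mat m \<rho>) (perm_mat n \<pi>))}"

definition wreath_perms :: "nat \<Rightarrow> nat \<Rightarrow> (nat \<Rightarrow> nat) set" where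
  "wreath_perms n m = {\<sigma>. \<sigma> permutes {..<n * m} \<and>
     (\<exists>\<pi> \<rho>. (\<forall>j<m. \<pi> j permutes {..<n}) \<and> \<rho> permutes {..<m} \<and>
        perm_mat (n * m) \<sigma> =
          diag_block_mat (map (\<lambda>j. perm_mat n (\<pi> j)) [0..<m]) * kronecker (perm_mat m \<rho>) (1\<^sub>m n))}"

(* Both sets are finite and nonempty, so that pmf_of_set is the uniform distribution on them. *)

lemma finite_tensor_perms [simp]: "finite (tensor_perms m n)"
  unfolding tensor_perms_def by (rule finite_subset[OF _ finite_permutations[of "{..<n * m}"]]) auto

lemma finite_wreath_perms [simp]: "finite (wreath_perms n m)"
  unfolding wreath_perms_def by (rule finite_subset[OF _ finite_permutations[of "{..<n * m}"]]) auto

lemma perm_mat_id [simp]: "perm_mat n id = 1\<^sub>m n"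
  by (rule eq_matI) (auto simp: perm_mat_def)

lemma kronecker_one [simp]: "kronecker (1\<^sub>m m) (1\<^sub>m n) = (1\<^sub>m (n * m) :: real mat)"
proof (rule eq_matI)
  fix i j assume ij: "i < dim_row (1\<^sub>m (n * m) :: real mat)" "j < dim_col (1\<^sub>m (n * m) :: real mat)"
  then have "n > 0"
    by (cases n) auto
  moreover have "i div n < m" "j div n < m"
    using ij by (auto simp: less_mult_imp_div_less mult.commute)
  moreover have "i = j \<longleftrightarrow> i div n = j div n \<and> i mod n = j mod n"
    by (metis div_mult_mod_eq)
  ultimately show "kronecker (1\<^sub>m m) (1\<^sub>m n) $$ (i, j) = (1\<^sub>m (n * m) :: real mat) $$ (i, j)"
    using ij by (auto simp: kronecker_def mult.commute)
qed (auto simp: kronecker_def)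

lemma diag_block_mat_one: "diag_block_mat (map (\<lambda>j. 1\<^sub>m n) xs) = (1\<^sub>m (n * length xs) :: real mat)"
proof (induction xs)
  case (Cons x xs)
  then show ?case
    by (intro eq_matI) (auto simp: Let_def)
qed (intro eq_matI; auto)

lemma tensor_perms_nonempty [simp]: "tensor_perms m n \<noteq> {}"
proof -
  have "id \<in> tensor_perms m n"
    unfolding tensor_perms_def using permutes_id[of "{..<m}"] permutes_id[of "{..<n}"]
    by (force intro!: exI[of _ id] simp: permutes_id)
  then show ?thesis by blast
qed

lemma wreath_perms_nonempty [simp]: "wreath_perms n m \<noteq> {}"
proof -
  have "id \<in> wreath_perms n m"
    unfolding wreath_perms_def
    by (auto intro!: exI[of _ "\<lambda>_. id"] exI[of _ id] simp: permutes_id diag_block_mat_one)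
  then show ?thesis by blast
qed


subsection \<open>The constant\<close>

definition c_star :: real where
  "c_star = (THE x. x \<ge> 2 \<and> x * ln (2 * exp 1 / x) = 1)"

lemma c_star_ex1: "\<exists>!x::real. x \<ge> 2 \<and> x * ln (2 * exp 1 / x) = 1"
proof -
  define f where "f = (\<lambda>x::real. x * ln (2 * exp 1 / x))"
  have deriv: "(f has_real_derivative (ln (2 * exp 1 / x) - 1)) (at x)" if "x > 0" for x
    unfolding f_def using that
    by (auto intro!: derivative_eq_intros simp: field_simps power2_eq_square)
  have decr: "f y < f x" if "2 \<le> x" "x < y" for x y
  proof (rule DERIV_neg_imp_decreasing_open[OF that(2)])
    fix z assume z: "x < z" "z < y"
    have "ln (2 * exp 1 / z) < ln (exp 1)"
      using z that by (subst ln_less_cancel_iff) (auto simp: field_simps)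
    then show "\<exists>d. (f has_real_derivative d) (at z) \<and> d < 0"
      using deriv[of z] z that by (intro exI[of _ "ln (2 * exp 1 / z) - 1"]) auto
  next
    show "continuous_on {x..y} f"
      using that by (intro DERIV_continuous_on[OF has_field_derivative_at_within[OF deriv]]) auto
  qed
  have "\<exists>x\<ge>2. x \<le> 2 * exp 1 \<and> f x = 1"
  proof (rule IVT2)
    show "\<forall>x. 2 \<le> x \<and> x \<le> 2 * exp 1 \<longrightarrow> isCont f x"
      by (auto intro!: DERIV_isCont[OF deriv])
  qed (auto simp: f_def)
  then obtain x where x: "x \<ge> 2" "f x = 1"
    by auto
  show ?thesis
  proof (rule ex1I[of _ x])
    show "2 \<le> x \<and> x * ln (2 * exp 1 / x) = 1"
      using x by (simp add: f_def)
    fix y :: real assume "2 \<le> y \<and> y * ln (2 * exp 1 / y) = 1"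
    then have y: "2 \<le> y" "f y = 1"
      by (auto simp: f_def)
    show "y = x"
      using decr[of x y] decr[of y x] x y by (cases x y rule: linorder_cases) auto
  qed
qed

end

theory Submission
  imports Defs "HOL-Real_Asymp.Real_Asymp"
begin

text \<open>The tree of a block permutation arises from the tree of \<open>\<rho>\<close> by blowing up each node to the tree of
  its block; the subtrees of a node then hang off the two ends of the left and right spines of the
  blown-up node. Spines of a random binary search tree on \<open>n\<close> keys have length about \<open>ln n\<close> and its
  height is about \<open>c_star * ln n\<close>, so the height of the composite tree is about
  \<open>(h + c_star) * ln n\<close>, where \<open>h\<close> is the height of the tree of \<open>\<rho>\<close>.

  The tail \<open>P (height > j)\<close> for \<open>n\<close> keys satisfies a deterministic recursion in \<open>j\<close> given by a
  monotone operator \<open>branch\<close>. The upper bound on the height is an explicit supersolution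
  \<open>z\<^sup>-\<^sup>j (n+1)\<^sup>2\<^sup>z\<^sup>-\<^sup>1\<close>. For the lower bound, \<open>k\<close> steps of the linearised operator multiply a small step
  function by more than one while its threshold moves by a factor \<open>exp (k / c)\<close>, for every
  \<open>c < c_star\<close> and large \<open>k\<close>. This yields probability bounded away from zero, and conditioning on
  the root squares the failure probability, which amplifies it to probability one.\<close>

subsection \<open>The recursion for the height of a random binary search tree\<close>

text \<open>The constant is the same in both halves for one reason. At depth \<open>c * ln n\<close>
  the supersolution is best with \<open>z = c / 2\<close>, where it is a power of \<open>n\<close>
  with exponent \<open>c * ln (2 * exp 1 / c) - 1\<close>. By Stirling's formula the
  \<open>k\<close>-step multiplier of the lower bound is, up to a polynomial factor, the
  \<open>k\<close>-th power of \<open>2 * exp (1 - 1 / c) / c\<close>, whose logarithm is that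
  exponent divided by \<open>c\<close>. On \<open>c \<ge> 2\<close> both change sign exactly at
  \<open>c_star\<close>.

  The obstacle below \<open>c_star\<close> is the product term in \<open>branch\<close>: growth is
  linear only while the values are small. Hence a seed \<delta> so small that
  \<open>2 ^ k * \<delta>\<close> stays below one, and a separate amplification afterwards.

  In the composite tree both spines have the same order \<open>ln n\<close>, so an edge of the tree
  of \<rho> costs the same whichever way it turns, and only the height of that tree survives in the
  limit. As \<open>m\<close> is fixed, \<open>ln (n * m)\<close> and \<open>ln n\<close> differ by a
  constant.\<close>

definition branch :: "(nat \<Rightarrow> real) \<Rightarrow> nat \<Rightarrow> real" where
  "branch g n = (\<Sum>u<n. g u + g (n - 1 - u) - g u * g (n - 1 - u)) / real n"

text \<open>\<open>branch\<close> averages \<open>1 - (1 - g u) * (1 - g (n - 1 - u))\<close> over a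
  uniform root rank \<open>u\<close>: the chance that an event occurs in at least one of two
  independent subtrees. Started from the indicator of a nonempty tree, its iterates are P(height >
  j) with height counted in nodes; \<open>prob_height_le\<close> proves this.\<close>

definition height_tail :: "nat \<Rightarrow> nat \<Rightarrow> real" where
  "height_tail j = (branch ^^ j) (\<lambda>n. if n = 0 then 0 else 1)"

lemma height_tail_0: "height_tail 0 n = (if n = 0 then 0 else 1)"
  by (simp add: height_tail_def)

lemma height_tail_Suc: "height_tail (Suc j) = branch (height_tail j)"
  by (simp add: height_tail_def)

lemma height_tail_add: "height_tail (i + j) = (branch ^^ i) (height_tail j)"
  by (simp add: height_tail_def funpow_add)

text \<open>The expression is \<open>1 - (1 - x) * (1 - y)\<close>, which increases in each variable
  while the other is at most one.\<close>

lemma prob_or_mono: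
  fixes x y x' y' :: real
  assumes "x \<le> x'" "y \<le> y'" "x' \<le> 1" "y \<le> 1"
  shows "x + y - x * y \<le> x' + y' - x' * y'"
proof -
  have "(1 - x') * (1 - y') \<le> (1 - x) * (1 - y)"
    using assms
    by (meson diff_ge_0_iff_ge diff_left_mono mult_left_mono mult_right_mono order_trans)
  then show ?thesis
    by (simp add: algebra_simps)
qed

lemma branch_mono:
  assumes "\<And>u. g u \<le> g' u" "\<And>u. g' u \<le> 1"
  shows "branch g n \<le> branch g' n"
  unfolding branch_def using assms
  by (intro divide_right_mono sum_mono prob_or_mono) (auto intro: order_trans)

lemma branch_const: "branch (\<lambda>_. q) n = (if n = 0 then 0 else q + q - q * q)"
  by (simp add: branch_def)

lemma branch_nonneg:
  assumes "\<And>u. 0 \<le> g u" "\<And>u. g u \<le> 1"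
  shows "0 \<le> branch g n"
  using branch_mono[of "\<lambda>_. 0" g n] assms by (simp add: branch_const split: if_splits)

lemma branch_le_one:
  assumes "\<And>u. g u \<le> 1"
  shows "branch g n \<le> 1"
  using branch_mono[of g "\<lambda>_. 1" n] assms by (simp add: branch_const split: if_splits)

lemma branch_funpow_bounds:
  assumes "\<And>u. 0 \<le> g u" "\<And>u. g u \<le> 1"
  shows "0 \<le> (branch ^^ k) g n" "(branch ^^ k) g n \<le> 1"
  by (induction k arbitrary: n) (auto intro: assms branch_nonneg branch_le_one)

lemma branch_funpow_mono:
  assumes "\<And>u. g u \<le> g' u" "\<And>u. 0 \<le> g' u" "\<And>u. g' u \<le> 1"
  shows "(branch ^^ k) g n \<le> (branch ^^ k) g' n"
proof (induction k arbitrary: n)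
  case (Suc k)
  then show ?case
    using branch_funpow_bounds[of g'] assms by (auto intro!: branch_mono)
qed (use assms in auto)

lemma height_tail_nonneg: "0 \<le> height_tail j n" and height_tail_le_one: "height_tail j n \<le> 1"
  unfolding height_tail_def by (rule branch_funpow_bounds; simp)+

lemma height_tail_antimono: "i \<le> j \<Longrightarrow> height_tail j n \<le> height_tail i n"
proof (induction j arbitrary: n rule: dec_induct)
  case (step j)
  have "height_tail (Suc j) n \<le> height_tail j n" for n
  proof (induction j arbitrary: n)
    case 0
    then show ?case
      using height_tail_le_one[of 1] by (auto simp: height_tail_0 height_tail_Suc branch_def)
  next
    case (Suc j)
    then show ?case
      using height_tail_le_one by (subst (1 2) height_tail_Suc) (rule branch_mono)
  qed
  with step show ?case
    by (meson order_trans)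
qed simp

text \<open>A uniformly chosen split of \<open>n\<close> dominates a uniformly chosen split of \<open>n - 1\<close>: both sides
  are compared after weighting the split \<open>(u, n - u)\<close> with \<open>u + (n - u) = n\<close>.\<close>

lemma branch_incseq:
  assumes "mono g" "\<And>u. 0 \<le> g u" "\<And>u. g u \<le> 1"
  shows "mono (branch g)"
proof (rule incseq_SucI)
  fix n
  define a where "a = (\<lambda>u v. g u + g v - g u * g v)"
  have a_mono: "a u v \<le> a u' v'" if "u \<le> u'" "v \<le> v'" for u v u' v'
    unfolding a_def using assms monoD[OF assms(1) that(1)] monoD[OF assms(1) that(2)]
    by (intro prob_or_mono) auto
  show "branch g n \<le> branch g (Suc n)"
  proof (cases "n = 0")
    case True
    then show ?thesis
      using branch_nonneg[of g "Suc n"] assms by (simp add: branch_def)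
  next
    case False
    \<comment> \<open>The weights \<open>v + 1\<close> and \<open>n - v\<close> add up to
      \<open>n + 1\<close>. Terms with the first weight have their left part enlarged by one, those
      with the second their right part; after the shift the split \<open>(v, n - v)\<close> carries
      weight \<open>v + (n - v) = n\<close>.\<close>
    have "(n + 1) * (\<Sum>v<n. a v (n - 1 - v))
        = (\<Sum>v<n. real (v + 1) * a v (n - 1 - v)) + (\<Sum>v<n. real (n - v) * a v (n - 1 - v))"
      unfolding sum.distrib[symmetric] sum_distrib_left
      by (rule sum.cong) (auto simp: of_nat_diff algebra_simps)
    also have "\<dots> \<le> (\<Sum>v<n. real (v + 1) * a (Suc v) (n - Suc v)) + (\<Sum>v<n. real (n - v) * a v (n - v))"
      by (intro add_mono sum_mono mult_left_mono a_mono) auto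
    also have "(\<Sum>v<n. real (v + 1) * a (Suc v) (n - Suc v)) = (\<Sum>v<Suc n. real v * a v (n - v))"
      by (subst sum.lessThan_Suc_shift) simp
    also have "(\<Sum>v<n. real (n - v) * a v (n - v)) = (\<Sum>v<Suc n. real (n - v) * a v (n - v))"
      by simp
    also have "(\<Sum>v<Suc n. real v * a v (n - v)) + \<dots> = n * (\<Sum>v<Suc n. a v (n - v))"
      unfolding sum.distrib[symmetric] sum_distrib_left
      by (rule sum.cong) (auto simp: of_nat_diff algebra_simps)
    finally show ?thesis
      using False unfolding branch_def a_def by (simp add: field_simps)
  qed
qed

lemma branch_funpow_incseq:
  assumes "mono g" "\<And>u. 0 \<le> g u" "\<And>u. g u \<le> 1"
  shows "mono ((branch ^^ k) g)"
  by (induction k) (auto intro!: assms branch_incseq branch_funpow_bounds)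

section \<open>Comparison with the linear averaging operator, and the upper bound\<close>

lemma sum_rev_lessThan: "(\<Sum>u<n. f (n - Suc u)) = (\<Sum>u<n. f u)" for f :: "nat \<Rightarrow> 'a::comm_monoid_add"
  using sum.nat_diff_reindex[of f n] by simp

lemma branch_le_double_average:
  assumes "\<And>u. 0 \<le> g u"
  shows "branch g n \<le> 2 * (\<Sum>u<n. g u) / n"
proof -
  have "branch g n \<le> (\<Sum>u<n. g u + g (n - 1 - u)) / n"
    unfolding branch_def using assms by (intro divide_right_mono sum_mono) auto
  then show ?thesis
    by (simp add: sum.distrib sum_rev_lessThan)
qed

text \<open>One factor of each product is at most \<delta>, so the product term lowers the linear
  factor 2 by at most \<delta>.\<close>

lemma branch_ge_average:
  assumes "\<And>u. 0 \<le> g u" "\<And>u. g u \<le> \<delta>"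
  shows "(2 - \<delta>) * (\<Sum>u<n. g u) / n \<le> branch g n"
proof -
  have "(2 - \<delta>) * (\<Sum>u<n. g u) = (\<Sum>u<n. g u + g (n - 1 - u)) - (\<Sum>u<n. g u * \<delta>)"
    unfolding sum_distrib_right[symmetric] sum.distrib
    by (simp add: sum_rev_lessThan[of g] algebra_simps)
  also have "\<dots> \<le> (\<Sum>u<n. g u + g (n - 1 - u) - g u * g (n - 1 - u))"
    unfolding sum_subtractf[symmetric] using assms
    by (intro sum_mono diff_left_mono mult_left_mono) auto
  finally show ?thesis
    unfolding branch_def by (intro divide_right_mono) auto
qed

text \<open>A discrete form of the integral of a power. The shift by one makes it hold without error
  term, so \<open>(n + 1) powr \<alpha>\<close> can be pushed through the averaging operator any
  number of times.\<close>

lemma sum_powr_le: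
  fixes \<alpha> :: real
  assumes "\<alpha> \<ge> 1"
  shows "(1 + \<alpha>) * (\<Sum>u<n. real (u + 1) powr \<alpha>) \<le> n * real (n + 1) powr \<alpha>"
proof (induction n)
  case (Suc n)
  \<comment> \<open>Bernoulli's inequality for a real exponent, from the weighted
    arithmetic-geometric mean inequality for \<open>a\<close> and 1 with weights
    \<open>1 / \<alpha>\<close> and \<open>1 - 1 / \<alpha>\<close>.\<close>
  have "1 + \<alpha> * (1 / (n + 1)) \<le> (1 + 1 / (n + 1)) powr \<alpha>"
  proof -
    define a where "a = 1 + \<alpha> * (1 / (n + 1))"
    have a: "a > 0"
      using assms by (auto simp: a_def intro!: add_pos_nonneg)
    have "a powr (1 / \<alpha>) \<le> (1 / \<alpha>) * a + (1 - 1 / \<alpha>)"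
      using Youngs_inequality_0[of "1 / \<alpha>" "1 - 1 / \<alpha>" a 1] a assms by simp
    also have "(1 / \<alpha>) * a + (1 - 1 / \<alpha>) = 1 + 1 / (n + 1)"
      unfolding a_def using assms by (simp add: distrib_left del: of_nat_Suc of_nat_add)
    finally have "(a powr (1 / \<alpha>)) powr \<alpha> \<le> (1 + 1 / (n + 1)) powr \<alpha>"
      using assms by (intro powr_mono2) auto
    then show ?thesis
      using a assms by (simp add: powr_powr a_def)
  qed
  also have "(1 + 1 / real (n + 1)) = real (n + 2) / real (n + 1)"
    by (simp add: field_simps)
  finally have "(n + 1 + \<alpha>) * real (n + 1) powr \<alpha> \<le> (n + 1) * real (n + 2) powr \<alpha>"
    by (simp add: powr_divide field_simps)
  then show ?case
    using Suc by (simp add: algebra_simps)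
qed simp

text \<open>With \<open>\<alpha> = 2 * z - 1\<close> the doubled average multiplies
  \<open>(n + 1) powr \<alpha>\<close> by at most \<open>2 / (1 + \<alpha>) = 1 / z\<close>, one
  factor for each level.\<close>

lemma height_tail_le:
  assumes "z \<ge> 1"
  shows "height_tail j n \<le> (1 / z) ^ j * real (n + 1) powr (2 * z - 1)"
proof (induction j arbitrary: n)
  case 0
  have "1 \<le> real (n + 1) powr (2 * z - 1)"
    using assms by (intro ge_one_powr_ge_zero) auto
  then show ?case
    by (simp add: height_tail_0)
next
  case (Suc j)
  show ?case
  proof (cases "n = 0")
    case True
    then show ?thesis
      using assms by (simp add: height_tail_Suc branch_def)
  next
    case False
    have "height_tail (Suc j) n \<le> 2 * (\<Sum>u<n. height_tail j u) / n"
      unfolding height_tail_Suc by (intro branch_le_double_average height_tail_nonneg)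
    also have "\<dots> \<le> 2 * (\<Sum>u<n. (1 / z) ^ j * real (u + 1) powr (2 * z - 1)) / n"
      by (intro divide_right_mono mult_left_mono sum_mono Suc) auto
    also have "\<dots> = (1 / z) ^ Suc j * ((1 + (2 * z - 1)) * (\<Sum>u<n. real (u + 1) powr (2 * z - 1)) / n)"
      using assms by (simp add: sum_distrib_left sum_divide_distrib field_simps)
    also have "\<dots> \<le> (1 / z) ^ Suc j * real (n + 1) powr (2 * z - 1)"
      using sum_powr_le[of "2 * z - 1" n] assms False
      by (intro mult_left_mono) (auto simp: field_simps)
    finally show ?thesis .
  qed
qed


subsection \<open>The linearised recursion below the critical constant\<close>

text \<open>Mean value estimate for a power, with the derivative taken at the larger end.\<close>

lemma power_Suc_diff_le:
  fixes a b :: real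
  assumes "0 \<le> b" "b \<le> a"
  shows "a ^ Suc i - b ^ Suc i \<le> real (Suc i) * a ^ i * (a - b)"
proof (induction i)
  case (Suc i)
  have "a ^ Suc (Suc i) - b ^ Suc (Suc i) = a * (a ^ Suc i - b ^ Suc i) + b ^ Suc i * (a - b)"
    by (simp add: algebra_simps)
  also have "\<dots> \<le> a * (real (Suc i) * a ^ i * (a - b)) + a ^ Suc i * (a - b)"
    using Suc assms by (intro add_mono mult_left_mono mult_right_mono power_mono) auto
  also have "\<dots> = real (Suc (Suc i)) * a ^ Suc i * (a - b)"
    by (simp add: algebra_simps)
  finally show ?case .
qed simp

text \<open>A discrete form of \<open>\<integral> ln\<^sup>i(u/M) / u du = ln\<^sup>i\<^sup>+\<^sup>1(n/M) / (i+1)\<close>; replacing \<open>M\<close> by \<open>M + 1\<close>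
  absorbs the error of the discretisation.\<close>

lemma sum_ln_power_ge:
  fixes M :: real
  assumes "M > 0" "real n \<ge> M + 1"
  shows "ln (n / (M + 1)) ^ Suc i / Suc i \<le> (\<Sum>u<n. if real u \<ge> M then ln (u / M) ^ i / u else 0)"
proof -
  \<comment> \<open>Truncation at zero lets the induction start at \<open>n = 0\<close> and pass
    through all \<open>n\<close> below the threshold, where the sum has no terms yet.\<close>
  define R where "R = (\<lambda>n::nat. (max 0 (ln (n / (M + 1)))) ^ Suc i / Suc i)"
  define S where "S = (\<lambda>n::nat. \<Sum>u<n. if real u \<ge> M then ln (u / M) ^ i / u else 0)"
  have "R n \<le> S n" for n
  proof (induction n)
    case 0
    then show ?case by (simp add: R_def S_def)
  next
    case (Suc n)
    show ?case
    proof (cases "real n \<ge> M")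
      case False
      then have "ln (Suc n / (M + 1)) \<le> 0"
        using assms by (intro ln_le_zero_iff[THEN iffD2]) auto
      then have "R (Suc n) = 0"
        by (simp add: R_def)
      moreover have "0 \<le> S (Suc n)"
        unfolding S_def using assms by (intro sum_nonneg) auto
      ultimately show ?thesis by simp
    next
      case True
      define a b where "a = ln (Suc n / (M + 1))" and "b = max 0 (ln (n / (M + 1)))"
      have n: "n > 0"
        using True assms by (cases n) auto
      have a0: "0 \<le> a"
        unfolding a_def using True assms by (intro ln_ge_zero) (auto simp: field_simps)
      have ab: "b \<le> a"
        using a0 n assms by (auto simp: a_def b_def intro!: divide_right_mono)
      \<comment> \<open>For \<open>n \<ge> M\<close> one has
        \<open>(n + 1) / (M + 1) \<le> n / M\<close>; this is what the shifted threshold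
        buys.\<close>
      have "a \<le> ln (n / M)"
        unfolding a_def using True assms n by (subst ln_le_cancel_iff) (auto simp: field_simps)
      have "a - b \<le> a - ln (n / (M + 1))"
        by (simp add: b_def)
      also have "\<dots> = ln (1 + 1 / n)"
      proof -
        have "1 + 1 / real n = Suc n / n"
          using n by (simp add: field_simps)
        then show ?thesis
          unfolding a_def using n assms by (simp add: ln_div del: of_nat_Suc)
      qed
      also have "\<dots> \<le> 1 / n"
        by (intro ln_add_one_self_le_self) simp
      finally have "a - b \<le> 1 / n" .
      have "a ^ Suc i - b ^ Suc i \<le> Suc i * a ^ i * (a - b)"
        using ab by (intro power_Suc_diff_le) (auto simp: b_def)
      also have "\<dots> \<le> Suc i * ln (n / M) ^ i * (1 / n)"
        using a0 ab \<open>a - b \<le> 1 / n\<close> \<open>a \<le> ln (n / M)\<close>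
        by (intro mult_mono power_mono) auto
      finally have "(a ^ Suc i - b ^ Suc i) / Suc i \<le> ln (n / M) ^ i / n"
        by (simp add: field_simps)
      moreover have "R (Suc n) = a ^ Suc i / Suc i" "R n = b ^ Suc i / Suc i"
        using a0 unfolding R_def a_def b_def by (simp_all add: max_absorb2)
      moreover have "S (Suc n) = S n + ln (n / M) ^ i / n"
        using True by (simp add: S_def)
      ultimately show ?thesis
        using Suc by (simp add: diff_divide_distrib)
    qed
  qed
  from this[of n] show ?thesis
    using assms unfolding R_def S_def by (simp add: max_absorb2)
qed

text \<open>A crude doubling bound; it keeps the intermediate iterates small, so that
  \<open>branch_ge_average\<close> loses little in each of the \<open>k\<close> steps.\<close>

lemma branch_funpow_le:
  assumes "\<And>u. 0 \<le> g u" "\<And>u. g u \<le> 1" "\<And>u. g u \<le> q"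
  shows "(branch ^^ i) g n \<le> 2 ^ i * q"
proof (induction i arbitrary: n)
  case (Suc i)
  have "branch ((branch ^^ i) g) n \<le> 2 * (\<Sum>u<n. (branch ^^ i) g u) / n"
    using assms by (intro branch_le_double_average branch_funpow_bounds)
  also have "\<dots> \<le> 2 * (\<Sum>u<n. 2 ^ i * q) / n"
    by (intro divide_right_mono mult_left_mono sum_mono Suc) auto
  also have "\<dots> \<le> 2 ^ Suc i * q"
    using assms(1)[of 0] assms(3)[of 0] by (cases "n = 0") auto
  finally show ?case by simp
qed (use assms in auto)

text \<open>The step function is at least \<open>\<delta> * x / n\<close> beyond \<open>x\<close>.
  In the continuum, averaging \<open>x / u * ln (u / x) ^ i / fact i\<close> over
  \<open>[x, n]\<close> raises \<open>i\<close> by one and keeps the shape, which explains the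
  formula. Each discrete step moves the threshold by one, whence \<open>x + i\<close>; the factor
  \<open>2 - 2 ^ k * \<delta>\<close> is common to all steps.\<close>

lemma branch_funpow_step_ge:
  assumes "x > 0" "0 \<le> \<delta>" "2 ^ k * \<delta> \<le> 1" "i \<le> k" "real n \<ge> x + i"
  shows "\<delta> * (2 - 2 ^ k * \<delta>) ^ i * (x / n * ln (n / (x + i)) ^ i / fact i)
           \<le> (branch ^^ i) (\<lambda>u. if real u \<ge> x then \<delta> else 0) n"
  using assms(4,5)
proof (induction i arbitrary: n)
  case 0
  then show ?case
    using assms(1,2) by (simp add: field_simps mult_left_mono)
next
  case (Suc i)
  define g :: "nat \<Rightarrow> real" where "g = (\<lambda>u. if real u \<ge> x then \<delta> else 0)"
  define r where "r = 2 - 2 ^ k * \<delta>"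
  have \<delta>1: "\<delta> \<le> 1"
    using assms(2,3) by (smt (verit, best) mult_le_cancel_right1 one_le_power)
  have r: "r \<ge> 1"
    using assms by (simp add: r_def)
  have g: "0 \<le> g u" "g u \<le> 1" "g u \<le> \<delta>" for u
    using \<delta>1 assms by (auto simp: g_def)
  have le: "(branch ^^ i) g u \<le> 2 ^ k * \<delta>" for u
  proof -
    have "(branch ^^ i) g u \<le> 2 ^ i * \<delta>"
      by (intro branch_funpow_le g)
    also have "\<dots> \<le> 2 ^ k * \<delta>"
      using assms Suc by (intro mult_right_mono power_increasing) auto
    finally show ?thesis .
  qed
  define M where "M = x + i"
  have M: "M > 0" "real n \<ge> M + 1" "n > 0"
    using assms Suc by (auto simp: M_def intro: gr0I)
  have "\<delta> * r ^ Suc i * (x / n * ln (n / (x + Suc i)) ^ Suc i / fact (Suc i))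
      = r * (\<delta> * r ^ i * (x / fact i)) * (ln (n / (M + 1)) ^ Suc i / Suc i) / n"
    by (simp add: M_def field_simps)
  also have "\<dots> \<le> r * (\<delta> * r ^ i * (x / fact i)) * (\<Sum>u<n. if real u \<ge> M then ln (u / M) ^ i / u else 0) / n"
    using r assms M by (intro divide_right_mono mult_left_mono sum_ln_power_ge) auto
  also have "\<dots> = r * (\<Sum>u<n. if real u \<ge> M then \<delta> * r ^ i * (x / u * ln (u / M) ^ i / fact i) else 0) / n"
    unfolding sum_distrib_left sum_divide_distrib
    by (intro sum.cong) (auto simp: field_simps)
  also have "\<dots> \<le> r * (\<Sum>u<n. (branch ^^ i) g u) / n"
  proof (intro divide_right_mono mult_left_mono sum_mono)
    fix u
    show "(if real u \<ge> M then \<delta> * r ^ i * (x / u * ln (u / M) ^ i / fact i) else 0) \<le> (branch ^^ i) g u"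
      using Suc.IH[of u] Suc.prems branch_funpow_bounds(1)[of g i u] g
      by (auto simp: M_def r_def g_def)
  qed (use r in auto)
  also have "\<dots> \<le> branch ((branch ^^ i) g) n"
    unfolding r_def by (intro branch_ge_average branch_funpow_bounds g le)
  finally show ?case
    by (simp add: g_def r_def)
qed

text \<open>Stirling's bound up to a factor linear in \<open>k\<close>, harmless against exponential
  growth. The induction rests on \<open>exp 1 \<le> (1 + 1 / k) ^ (k + 1)\<close>.\<close>

lemma fact_le_exp_power: "k \<ge> 1 \<Longrightarrow> fact k \<le> real k * exp 1 * (k / exp 1) ^ k"
proof (induction k rule: dec_induct)
  case (step k)
  have "exp 1 \<le> (1 + 1 / real k) ^ Suc k"
  proof -
    have "1 / (real k + 1) \<le> - ln (1 - 1 / (real k + 1))"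
      using ln_le_minus_one[of "1 - 1 / (real k + 1)"] step by (simp add: field_simps)
    also have "\<dots> = ln (inverse (1 - 1 / (real k + 1)))"
      using step by (subst ln_inverse) (auto simp: field_simps)
    also have "inverse (1 - 1 / (real k + 1)) = 1 + 1 / real k"
      using step by (simp add: field_simps)
    finally have "1 \<le> real (Suc k) * ln (1 + 1 / real k)"
      using step by (simp add: field_simps)
    also have "\<dots> = ln ((1 + 1 / real k) ^ Suc k)"
      using step by (subst ln_realpow) (auto intro: add_pos_nonneg)
    finally show ?thesis
      by (subst (asm) ln_ge_iff) (intro zero_less_power add_pos_nonneg; simp)
  qed
  then have "fact (Suc k) * exp 1 \<le> real (Suc k) * fact k * (1 + 1 / real k) ^ Suc k"
    by (simp add: mult_left_mono)
  also have "\<dots> \<le> real (Suc k) * (real k * exp 1 * (k / exp 1) ^ k) * (1 + 1 / real k) ^ Suc k"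
    using step by (intro mult_right_mono mult_left_mono) auto
  also have "1 + 1 / real k = Suc k / k"
    using step by (simp add: field_simps)
  also have "real (Suc k) * (real k * exp 1 * (k / exp 1) ^ k) * (Suc k / k) ^ Suc k
      = (real (Suc k) * exp 1 * (Suc k / exp 1) ^ Suc k) * exp 1"
    using step by (simp add: power_divide field_simps)
  finally show ?case by simp
qed simp

text \<open>At \<open>n = x * exp (k / c)\<close> the gain of \<open>branch_funpow_step_ge\<close>
  tends to this quantity as \<open>x\<close> grows and \<delta> shrinks. By Stirling it is at least
  \<open>L ^ k\<close> up to a linear factor, and the hypothesis on \<open>c\<close> says
  \<open>L > 1\<close>.\<close>

lemma supercritical_generation:
  fixes c :: real
  assumes "c > 0" "c * ln (2 * exp 1 / c) > 1"
  obtains k :: nat where "k \<ge> 1" "2 ^ k * (exp (- (k / c)) * (k / c) ^ k / fact k) > 1"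
proof -
  define L where "L = 2 * exp (1 - 1 / c) / c"
  have "L > 1"
  proof -
    have "0 < ln (2 * exp 1 / c) - 1 / c"
      using assms by (simp add: field_simps)
    also have "\<dots> = ln L"
      unfolding L_def using assms by (simp add: ln_mult ln_div exp_diff)
    finally show ?thesis
      using assms by (subst (asm) ln_gt_zero_iff) (auto simp: L_def)
  qed
  then have "filterlim (\<lambda>k::nat. L ^ k / (k * exp 1)) at_top at_top"
    by real_asymp
  then have "eventually (\<lambda>k::nat. L ^ k / (k * exp 1) > 1 \<and> k \<ge> 1) at_top"
    by (intro eventually_conj eventually_ge_at_top) (simp add: filterlim_at_top_dense)
  then obtain k :: nat where k: "L ^ k / (k * exp 1) > 1" "k \<ge> 1"
    using eventually_happens'[OF sequentially_bot] by blast
  have "exp (1 - 1 / c) ^ k = exp 1 ^ k * exp (- (k / c))"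
    by (simp add: algebra_simps flip: exp_of_nat_mult exp_add)
  then have "L ^ k / (k * exp 1) = 2 ^ k * exp (- (k / c)) * (k / c) ^ k / (k * exp 1 * (k / exp 1) ^ k)"
    using k assms
    by (simp add: L_def power_divide power_mult_distrib field_simps)
  also have "\<dots> \<le> 2 ^ k * exp (- (k / c)) * (k / c) ^ k / fact k"
    using fact_le_exp_power[OF k(2)] assms k by (intro divide_left_mono) auto
  finally have "1 < 2 ^ k * exp (- (k / c)) * (k / c) ^ k / fact k"
    by (rule less_le_trans[OF k(1)])
  then show ?thesis
    using that k(2) by (simp add: mult.assoc)
qed

text \<open>Self-reproduction: \<open>k\<close> steps return the value \<delta> while the threshold
  moves only by \<open>exp (k / c)\<close>. This can be repeated indefinitely.\<close>

lemma branch_seed: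
  fixes c :: real
  assumes "c > 0" "c * ln (2 * exp 1 / c) > 1"
  obtains k :: nat and \<delta> x0 :: real where "k \<ge> 1" "0 < \<delta>" "\<delta> \<le> 1" "x0 > 0"
    "\<And>x n. x \<ge> x0 \<Longrightarrow> real n \<ge> x * exp (k / c)
       \<Longrightarrow> \<delta> \<le> (branch ^^ k) (\<lambda>u. if real u \<ge> x then \<delta> else 0) n"
proof -
  obtain k :: nat where k: "k \<ge> 1" "2 ^ k * (exp (- (k / c)) * (k / c) ^ k / fact k) > 1"
    using supercritical_generation[OF assms] .
  define V where "V = exp (- (k / c)) * (k / c) ^ k / fact k"
  define E where "E = exp (k / c)"
  have E: "E > 1"
    using k assms by (simp add: E_def)
  \<comment> \<open>The gap between \<open>V'\<close> and \<open>V\<close> pays for the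
    discretisation, that between \<open>1 / 2 ^ k\<close> and \<open>V'\<close> for the product
    term.\<close>
  obtain V' where V': "1 / 2 ^ k < V'" "V' < V"
    using k dense[of "1 / 2 ^ k" V] by (auto simp: V_def field_simps)
  have "((\<lambda>\<delta>. (2 - 2 ^ k * \<delta>) ^ k * V') \<longlongrightarrow> (2 - 2 ^ k * 0) ^ k * V') (at_right (0::real))"
    by (intro tendsto_intros)
  then have "eventually (\<lambda>\<delta>. (2 - 2 ^ k * \<delta>) ^ k * V' > 1) (at_right (0::real))"
    using V' by (intro order_tendstoD(1)) (auto simp: field_simps)
  moreover have "eventually (\<lambda>\<delta>::real. \<delta> \<in> {0<..<1 / 2 ^ k}) (at_right 0)"
    by (intro eventually_at_right_real) simp
  ultimately obtain \<delta> :: real where \<delta>: "(2 - 2 ^ k * \<delta>) ^ k * V' > 1" "\<delta> > 0" "\<delta> < 1 / 2 ^ k"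
    using eventually_happens[OF eventually_conj] trivial_limit_at_right_real by force
  \<comment> \<open>The \<open>+ 1\<close> in the denominator allows for rounding
    \<open>x * E\<close> up to an integer.\<close>
  have "((\<lambda>x. x / (x * E + 1) * ln (x * E / (x + k)) ^ k / fact k)
      \<longlongrightarrow> inverse E * ln E ^ k / fact k) at_top"
  proof (intro tendsto_intros)
    show "((\<lambda>x. x / (x * E + 1)) \<longlongrightarrow> inverse E) at_top"
      using E by real_asymp
    show "((\<lambda>x. x * E / (x + k)) \<longlongrightarrow> E) at_top"
      by real_asymp
  qed (use E in auto)
  also have "inverse E * ln E ^ k / fact k = V"
    by (simp add: E_def V_def exp_minus field_simps)
  finally have "eventually (\<lambda>x. V' < x / (x * E + 1) * ln (x * E / (x + k)) ^ k / fact k) at_top"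
    using V' by (intro order_tendstoD(1))
  moreover have "eventually (\<lambda>x. x * E \<ge> x + k) at_top"
    using eventually_ge_at_top[of "k / (E - 1)"]
    by eventually_elim (use E in \<open>simp add: field_simps\<close>)
  ultimately have "eventually (\<lambda>x. x > 0 \<and> x * E \<ge> x + k \<and>
      V' < x / (x * E + 1) * ln (x * E / (x + k)) ^ k / fact k) at_top"
    using eventually_gt_at_top[of 0] by eventually_elim auto
  then obtain x0 :: real where x0: "\<And>x. x \<ge> x0 \<Longrightarrow> x > 0 \<and> x * E \<ge> x + k \<and>
      V' < x / (x * E + 1) * ln (x * E / (x + k)) ^ k / fact k"
    by (auto simp: eventually_at_top_linorder)
  show ?thesis
  proof (rule that)
    show "\<delta> \<le> 1"
      using \<delta> by (smt (verit, best) divide_le_eq_1 one_le_power)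
    fix x :: real and n' :: nat
    assume x: "x \<ge> x0" and n': "real n' \<ge> x * exp (k / c)"
    define g :: "nat \<Rightarrow> real" where "g = (\<lambda>u. if real u \<ge> x then \<delta> else 0)"
    \<comment> \<open>The explicit lower bound is not increasing in \<open>n\<close>, so it is used
      only at the smallest admissible integer; monotonicity of the iterates carries it to
      \<open>n'\<close>.\<close>
    define n where "n = nat \<lceil>x * E\<rceil>"
    note x0 = x0[OF x]
    have n: "x * E \<le> n" "n \<le> x * E + 1" "n \<le> n'"
      using x0 E n' unfolding n_def E_def by (auto simp: ceiling_le_iff)
    have pos: "x * E > 0"
      using x0 E by simp
    have "\<delta> * 1 \<le> \<delta> * ((2 - 2 ^ k * \<delta>) ^ k * V')"
      using \<delta> by (intro mult_left_mono) auto
    also have "\<dots> \<le> \<delta> * ((2 - 2 ^ k * \<delta>) ^ k * (x / (x * E + 1) * ln (x * E / (x + k)) ^ k / fact k))"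
      using \<delta> x0 by (intro mult_left_mono) (auto simp: field_simps)
    also have "\<dots> \<le> \<delta> * ((2 - 2 ^ k * \<delta>) ^ k * (x / n * ln (n / (x + k)) ^ k / fact k))"
    proof -
      have "0 \<le> ln (x * E / (x + k))"
        using x0 by (intro ln_ge_zero) (auto simp: field_simps)
      moreover have "ln (x * E / (x + k)) \<le> ln (n / (x + k))"
        using x0 n pos by (subst ln_le_cancel_iff) (auto intro!: divide_right_mono divide_pos_pos)
      moreover have "x / (x * E + 1) \<le> x / n"
        using x0 n pos by (intro divide_left_mono) auto
      ultimately show ?thesis
        using \<delta> x0 by (intro mult_left_mono divide_right_mono mult_mono power_mono)
          (auto simp: field_simps)
    qed
    also have "\<dots> \<le> (branch ^^ k) g n"
      using branch_funpow_step_ge[of x \<delta> k k n] x0 n \<delta> by (simp add: g_def field_simps)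
    also have "\<dots> \<le> (branch ^^ k) g n'"
      using \<delta> \<open>\<delta> \<le> 1\<close> n by (intro monoD[OF branch_funpow_incseq]) (auto simp: g_def mono_def)
    finally show "\<delta> \<le> (branch ^^ k) (\<lambda>u. if real u \<ge> x then \<delta> else 0) n'"
      by (simp add: g_def)
  qed (use k \<delta> x0[of x0] in auto)
qed


subsection \<open>The constant and the height asymptotics\<close>

text \<open>Makes \<open>c_star\<close> a threshold: the quantity is below one for
  \<open>c > c_star\<close> and above one for \<open>2 \<le> c < c_star\<close>. The core of the
  proof is \<open>y * ln (y / x) > y - x\<close>.\<close>

lemma x_ln_decreasing:
  fixes x y :: real
  assumes "2 \<le> x" "x < y"
  shows "y * ln (2 * exp 1 / y) < x * ln (2 * exp 1 / x)"
proof -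
  have "ln (2 * exp 1 / y) = 1 + ln 2 - ln y" "ln (2 * exp 1 / x) = 1 + ln 2 - ln x"
    using assms by (simp_all add: ln_div ln_mult)
  moreover have "y * ln (y / x) > y * (1 - x / y)"
  proof -
    have "ln (x / y) < x / y - 1"
      using assms ln_eq_minus_one[of "x / y"] ln_le_minus_one[of "x / y"] by fastforce
    then show ?thesis
      using assms by (intro mult_strict_left_mono) (auto simp: ln_div)
  qed
  moreover have "ln x \<ge> ln 2"
    using assms by simp
  then have "(y - x) * ln x \<ge> (y - x) * ln 2"
    using assms by (intro mult_left_mono) auto
  ultimately show ?thesis
    using assms by (simp add: ln_div algebra_simps)
qed

lemma c_star_eq: "c_star * ln (2 * exp 1 / c_star) = 1" and c_star_gt_2: "c_star > 2"
proof -
  have *: "c_star \<ge> 2 \<and> c_star * ln (2 * exp 1 / c_star) = 1"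
    unfolding c_star_def by (rule theI'[OF c_star_ex1])
  then show "c_star * ln (2 * exp 1 / c_star) = 1"
    by simp
  from * show "c_star > 2"
    by (cases "c_star = 2") auto
qed

lemma height_tail_tendsto_0:
  assumes "c > c_star"
  shows "(\<lambda>n. height_tail (nat \<lfloor>c * ln (real n)\<rfloor>) n) \<longlonglongrightarrow> 0"
proof -
  \<comment> \<open>The exponent \<open>2 * z - 1 - c * ln z\<close> at its minimiser
    \<open>z = c / 2\<close>; it equals \<open>c * ln (2 * exp 1 / c) - 1\<close>.\<close>
  define \<beta> where "\<beta> = c - 1 - c * ln (c / 2)"
  have c: "c > 2"
    using assms c_star_gt_2 by simp
  have "c * ln (2 * exp 1 / c) < 1"
    using x_ln_decreasing[of c_star c] c_star_eq c_star_gt_2 assms by simp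
  then have \<beta>: "\<beta> < 0"
    using c by (simp add: \<beta>_def ln_div ln_mult algebra_simps)
  show ?thesis
  proof (rule tendsto_sandwich[OF _ _ tendsto_const])
    show "eventually (\<lambda>n. 0 \<le> height_tail (nat \<lfloor>c * ln (real n)\<rfloor>) n) sequentially"
      by (simp add: height_tail_nonneg)
    show "eventually (\<lambda>n. height_tail (nat \<lfloor>c * ln (real n)\<rfloor>) n
        \<le> (c / 2) * (1 + 1 / real n) powr (c - 1) * real n powr \<beta>) sequentially"
      using eventually_gt_at_top[of 0]
    proof eventually_elim
      case (elim n)
      define j where "j = nat \<lfloor>c * ln (real n)\<rfloor>"
      have "0 \<le> c * ln (real n)"
        using c elim by auto
      \<comment> \<open>Rounding the depth down costs at most one factor
        \<open>z = c / 2\<close>.\<close>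
      then have j: "real j \<ge> c * ln (real n) - 1"
        unfolding j_def by linarith
      have "height_tail j n \<le> (1 / (c / 2)) ^ j * real (n + 1) powr (2 * (c / 2) - 1)"
        using c by (intro height_tail_le) auto
      also have "(1 / (c / 2)) ^ j = exp (- (ln (c / 2) * j))"
        using c by (simp add: exp_minus mult.commute[of _ "real j"] exp_of_nat_mult field_simps)
      also have "\<dots> \<le> exp (- (ln (c / 2) * (c * ln (real n) - 1)))"
        using c j by simp
      also have "- (ln (c / 2) * (c * ln (real n) - 1)) = ln (c / 2) + - (c * ln (c / 2)) * ln (real n)"
        by (simp add: algebra_simps)
      also have "exp \<dots> = (c / 2) * real n powr (- (c * ln (c / 2)))"
        unfolding exp_add using c elim by (simp add: powr_def)
      also have "real (n + 1) powr (2 * (c / 2) - 1) = (1 + 1 / real n) powr (c - 1) * real n powr (c - 1)"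
      proof -
        have "real (n + 1) = (1 + 1 / real n) * real n"
          using elim by (simp add: field_simps)
        then show ?thesis
          by (simp add: powr_mult)
      qed
      finally have "height_tail j n \<le> c / 2 * real n powr - (c * ln (c / 2)) *
          ((1 + 1 / real n) powr (c - 1) * real n powr (c - 1))"
        by (simp add: mult_right_mono)
      moreover have "real n powr \<beta> = real n powr - (c * ln (c / 2)) * real n powr (c - 1)"
        by (simp add: \<beta>_def flip: powr_add)
      ultimately show ?case
        by (simp add: j_def mult_ac)
    qed
    have "(\<lambda>n. (1 + 1 / real n) powr (c - 1)) \<longlonglongrightarrow> 1"
      by real_asymp
    moreover have "(\<lambda>n. real n powr \<beta>) \<longlonglongrightarrow> 0"
      using \<beta> by real_asymp
    ultimately have "(\<lambda>n. (c / 2) * (1 + 1 / real n) powr (c - 1) * real n powr \<beta>) \<longlonglongrightarrow> (c / 2) * 1 * 0"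
      by (intro tendsto_intros)
    then show "(\<lambda>n. (c / 2) * (1 + 1 / real n) powr (c - 1) * real n powr \<beta>) \<longlonglongrightarrow> 0"
      by simp
  qed
qed

text \<open>Asking for all \<open>c'\<close> strictly below \<open>c\<close> leaves room: passing to
  a subtree that holds a fixed fraction of the keys and has one level less to reach changes the
  ratio of depth to \<open>ln n\<close> only by a vanishing amount.\<close>

definition low_height_prob_le :: "real \<Rightarrow> real \<Rightarrow> bool" where
  "low_height_prob_le c q \<longleftrightarrow>
     (\<forall>c'<c. \<forall>\<^sub>F n in sequentially. \<forall>j. real j \<le> c' * ln n \<longrightarrow> 1 - height_tail j n \<le> q)"

lemma low_height_prob_le_seed:
  fixes c :: real
  assumes "c > 0" "c * ln (2 * exp 1 / c) > 1"
  obtains q where "0 \<le> q" "q < 1" "low_height_prob_le c q"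
proof -
  obtain k :: nat and \<delta> x0 :: real where k: "k \<ge> 1" "0 < \<delta>" "\<delta> \<le> 1" "x0 > 0"
    "\<And>x n. x \<ge> x0 \<Longrightarrow> real n \<ge> x * exp (k / c)
       \<Longrightarrow> \<delta> \<le> (branch ^^ k) (\<lambda>u. if real u \<ge> x then \<delta> else 0) n"
    using branch_seed[OF assms] by metis
  \<comment> \<open>Repeated use of \<open>branch_seed\<close>, each time with the step function
    below the current tail. The start is trivial because the tail at depth 0 is one on nonempty
    trees.\<close>
  have tail: "height_tail (k * i) n \<ge> \<delta>" if "real n \<ge> x0 * exp (k / c) ^ i" for i n
    using that
  proof (induction i arbitrary: n)
    case 0
    then show ?case
      using k by (auto simp: height_tail_0)
  next
    case (Suc i)
    define x where "x = x0 * exp (k / c) ^ i"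
    have x: "x \<ge> x0"
      using k assms unfolding x_def by (intro mult_le_cancel_left1[THEN iffD2]) auto
    have "\<delta> \<le> (branch ^^ k) (\<lambda>u. if real u \<ge> x then \<delta> else 0) n"
      using k(5)[OF x] Suc.prems by (simp add: x_def mult_ac)
    also have "\<dots> \<le> (branch ^^ k) (height_tail (k * i)) n"
      using Suc.IH by (intro branch_funpow_mono)
        (auto simp: x_def height_tail_nonneg height_tail_le_one)
    also have "\<dots> = height_tail (k * Suc i) n"
      by (simp add: height_tail_add)
    finally show ?case .
  qed
  show ?thesis
  proof (rule that[of "1 - \<delta>"])
    show "low_height_prob_le c (1 - \<delta>)"
      unfolding low_height_prob_le_def
    proof (intro allI impI)
      fix c' assume "c' < c"
      then have "eventually (\<lambda>n. c' * ln (real n) \<le> c * (ln (real n) - ln x0) - k) sequentially"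
        by real_asymp
      moreover have "eventually (\<lambda>n. real n \<ge> x0) sequentially"
        by real_asymp
      ultimately show "\<forall>\<^sub>F n in sequentially. \<forall>j. real j \<le> c' * ln n \<longrightarrow> 1 - height_tail j n \<le> 1 - \<delta>"
        using eventually_gt_at_top[of 0]
      proof eventually_elim
        case (elim n)
        \<comment> \<open>The number of \<open>k\<close>-step rounds until the threshold
          \<open>x0 * exp (k / c) ^ i\<close> reaches \<open>n\<close>; the depth reached is about
          \<open>c * ln n\<close>.\<close>
        define y where "y = c * (ln (real n) - ln x0) / k"
        define i where "i = nat \<lfloor>y\<rfloor>"
        have "y \<ge> 0"
          unfolding y_def using elim assms k by (auto intro!: divide_nonneg_nonneg mult_nonneg_nonneg)
        then have i: "real i \<le> y" "y \<le> real i + 1"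
          unfolding i_def by linarith+
        have ki: "real (k * i) \<ge> k * y - k"
          using mult_left_mono[OF i(2), of "real k"] by (simp add: algebra_simps)
        have "x0 * exp (k / c) ^ i = exp (ln x0 + i * (k / c))"
          using k by (simp add: exp_add flip: exp_of_nat_mult)
        also have "\<dots> \<le> exp (ln (real n))"
          using mult_right_mono[OF i(1), of "k / c"] assms k unfolding y_def by simp
        also have "\<dots> = n"
          using elim by simp
        finally have "height_tail (k * i) n \<ge> \<delta>"
          by (rule tail)
        moreover have "height_tail (k * i) n \<le> height_tail j n" if "real j \<le> c' * ln n" for j
        proof (rule height_tail_antimono)
          have "real j \<le> real (k * i)"
            using that elim ki k by (simp add: y_def)
          then show "j \<le> k * i"
            by (simp only: of_nat_le_iff)
        qed
        ultimately show ?case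
          by fastforce
      qed
    qed
  qed (use k in auto)
qed

lemma sum_indicator_less_le:
  assumes "x \<ge> 0"
  shows "(\<Sum>u<n. if real u < x then 1 else 0 :: real) \<le> x + 1"
proof -
  have "(\<Sum>u<n. if real u < x then 1 else 0 :: real) = card {u. u < n \<and> real u < x}"
    by (simp add: sum.If_cases Int_def)
  also have "card {u. u < n \<and> real u < x} \<le> card {..<nat \<lceil>x\<rceil>}"
    by (intro card_mono) (auto simp: less_ceiling_iff nat_less_iff zless_nat_eq_int_zless)
  finally show ?thesis
    using assms by simp linarith
qed

text \<open>Both subtrees of the root have linear size with probability close to one.\<close>

lemma low_height_prob_le_square:
  assumes "low_height_prob_le c q" "0 \<le> q" "q\<^sup>2 < q'" "c > 0"
  shows "low_height_prob_le c q'"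
  unfolding low_height_prob_le_def
proof (intro allI impI)
  fix c' assume "c' < c"
  define c'' where "c'' = (max c' 0 + c) / 2"
  have c'': "c' < c''" "c'' < c" "c'' > 0"
    using \<open>c' < c\<close> assms by (auto simp: c''_def)
  \<comment> \<open>Splits with a side below \<open>\<eta> * n\<close> have frequency at most
    \<open>2 * \<eta> + 2 / n\<close>. A quarter of the gap leaves another \<open>2 * \<eta>\<close>
    for the term \<open>2 / n\<close>.\<close>
  define \<eta> where "\<eta> = (q' - q\<^sup>2) / 4"
  have \<eta>: "\<eta> > 0"
    using assms by (simp add: \<eta>_def)
  have q': "q' \<ge> 0"
    using assms(3) zero_le_power2[of q] by linarith
  obtain N where N: "\<And>n j. n \<ge> N \<Longrightarrow> real j \<le> c'' * ln n \<Longrightarrow> 1 - height_tail j n \<le> q"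
    using assms(1) c'' unfolding low_height_prob_le_def eventually_sequentially by meson
  \<comment> \<open>A subtree has one level less to reach, with at least \<open>\<eta> * n\<close>
    keys.\<close>
  have "eventually (\<lambda>n. c' * ln (real n) - 1 \<le> c'' * ln (\<eta> * real n)) sequentially"
    using c'' \<eta> by real_asymp
  moreover have "eventually (\<lambda>n. \<eta> * real n \<ge> max 1 N) sequentially"
    using \<eta> by real_asymp
  moreover have "eventually (\<lambda>n. 2 / real n \<le> q' - q\<^sup>2 - 2 * \<eta>) sequentially"
    using \<eta> unfolding \<eta>_def by real_asymp
  ultimately show "\<forall>\<^sub>F n in sequentially. \<forall>j. real j \<le> c' * ln n \<longrightarrow> 1 - height_tail j n \<le> q'"
    using eventually_gt_at_top[of 0]
  proof eventually_elim
    case (elim n)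
    show ?case
    proof (intro allI impI)
      fix j assume j: "real j \<le> c' * ln n"
      show "1 - height_tail j n \<le> q'"
      proof (cases j)
        case 0
        then show ?thesis
          using elim q' by (simp add: height_tail_0)
      next
        case (Suc i)
        define F where "F = (\<lambda>u. 1 - height_tail i u)"
        define lo :: "nat \<Rightarrow> real" where "lo = (\<lambda>u. if real u < \<eta> * n then 1 else 0)"
        have F: "0 \<le> F u" "F u \<le> 1" for u
          by (auto simp: F_def height_tail_nonneg height_tail_le_one)
        have Fq: "F u \<le> q" if "\<not> real u < \<eta> * n" for u
        proof -
          have "c'' * ln (\<eta> * real n) \<le> c'' * ln u"
            using that elim c'' by (intro mult_left_mono) auto
          then have "real i \<le> c'' * ln u"
            using elim j Suc by simp
          then show ?thesis
            unfolding F_def using elim that by (intro N) linarith+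
        qed
        \<comment> \<open>The tree is low only if both subtrees are: at most
          \<open>q\<^sup>2\<close> if both are large, and at most one otherwise.\<close>
        have "F u * F v \<le> q\<^sup>2 + lo u + lo v" for u v
        proof (cases "real u < \<eta> * n \<or> real v < \<eta> * n")
          case True
          then have "1 \<le> lo u + lo v"
            by (auto simp: lo_def)
          moreover have "F u * F v \<le> 1"
            using F by (simp add: mult_le_one)
          ultimately show ?thesis
            using zero_le_power2[of q] by linarith
        next
          case False
          then show ?thesis
            using mult_mono[OF Fq Fq, of u v] F assms(2) by (simp add: lo_def power2_eq_square)
        qed
        then have "(\<Sum>u<n. F u * F (n - 1 - u)) \<le> (\<Sum>u<n. q\<^sup>2 + lo u + lo (n - 1 - u))"
          by (intro sum_mono)
        also have "\<dots> = n * q\<^sup>2 + 2 * (\<Sum>u<n. lo u)"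
          by (simp add: sum.distrib sum_rev_lessThan[of lo])
        also have "\<dots> \<le> n * q\<^sup>2 + 2 * (\<eta> * n + 1)"
          unfolding lo_def using \<eta> by (intro add_left_mono mult_left_mono sum_indicator_less_le) auto
        finally have "(\<Sum>u<n. F u * F (n - 1 - u)) / n \<le> q\<^sup>2 + 2 * \<eta> + 2 / n"
          using elim by (simp add: field_simps)
        also have "\<dots> \<le> q'"
          using elim by simp
        also have "(\<Sum>u<n. F u * F (n - 1 - u)) / n = 1 - height_tail j n"
        proof -
          have "(\<Sum>u<n. F u * F (n - 1 - u)) = (\<Sum>u<n. 1) - n * height_tail j n"
            unfolding Suc height_tail_Suc branch_def using elim
            by (simp add: F_def algebra_simps flip: sum_subtractf sum.distrib)
          then show ?thesis
            using elim by (simp add: field_simps)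
        qed
        finally show ?thesis .
      qed
    qed
  qed
qed

lemma low_height_prob_le_all:
  fixes c :: real
  assumes "c > 0" "c * ln (2 * exp 1 / c) > 1" "\<epsilon> > 0"
  shows "low_height_prob_le c \<epsilon>"
proof -
  obtain q where q: "0 \<le> q" "q < 1" "low_height_prob_le c q"
    using low_height_prob_le_seed[OF assms(1,2)] .
  \<comment> \<open>Squaring yields only bounds strictly above the square; \<open>r > q\<close>
    provides that margin, and geometric decay in \<open>r\<close> is enough.\<close>
  define r where "r = (1 + q) / 2"
  have r: "q < r" "0 < r" "r < 1"
    using q by (auto simp: r_def)
  have low: "low_height_prob_le c (r ^ Suc i)" for i
  proof (induction i)
    case 0
    show ?case
      using q(3) r unfolding low_height_prob_le_def
      by (force elim!: eventually_mono)
  next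
    case (Suc i)
    show ?case
    \<comment> \<open>For \<open>i = 0\<close> the square of \<open>r ^ Suc i\<close> equals the
      target, so strictness must come from \<open>q < r\<close>.\<close>
    proof (cases "i = 0")
      case True
      then show ?thesis
        using low_height_prob_le_square[OF q(3,1) _ assms(1), of "r\<^sup>2"] q r
        by (simp add: mult_strict_mono' numeral_2_eq_2)
    next
      case False
      then have "r ^ (Suc i * 2) < r ^ Suc (Suc i)"
        using r by (intro power_strict_decreasing) auto
      then show ?thesis
        using r by (intro low_height_prob_le_square[OF Suc] assms) (simp_all only: power_mult zero_le_power less_imp_le)
    qed
  qed
  obtain i where "r ^ i < \<epsilon>"
    using real_arch_pow_inv[OF assms(3) r(3)] by auto
  moreover have "r ^ Suc i \<le> r ^ i"
    using r by (intro power_decreasing) auto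
  ultimately have "r ^ Suc i \<le> \<epsilon>"
    by simp
  then show ?thesis
    using low[of i] unfolding low_height_prob_le_def
    by (force elim!: eventually_mono)
qed

lemma height_tail_tendsto_1:
  assumes "c < c_star"
  shows "(\<lambda>n. height_tail (nat \<lfloor>c * ln (real n)\<rfloor>) n) \<longlonglongrightarrow> 1"
proof (rule order_tendstoI)
  fix a :: real assume "1 < a"
  then show "\<forall>\<^sub>F n in sequentially. height_tail (nat \<lfloor>c * ln (real n)\<rfloor>) n < a"
    using height_tail_le_one le_less_trans by (intro always_eventually) blast
next
  fix a :: real assume a: "a < 1"
  \<comment> \<open>The maximum with 2 puts \<open>d\<close> into the range where
    \<open>x_ln_decreasing\<close> applies, also when \<open>c\<close> is small or negative.\<close>
  define d where "d = (max c 2 + c_star) / 2"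
  have d: "d \<ge> 2" "max c 0 < d" "d < c_star"
    using assms c_star_gt_2 by (auto simp: d_def)
  have "low_height_prob_le d ((1 - a) / 2)"
    using d x_ln_decreasing[of d c_star] c_star_eq a by (intro low_height_prob_le_all) auto
  then have "\<forall>\<^sub>F n in sequentially. \<forall>j. real j \<le> max c 0 * ln n \<longrightarrow> 1 - height_tail j n \<le> (1 - a) / 2"
    using d unfolding low_height_prob_le_def by blast
  then show "\<forall>\<^sub>F n in sequentially. a < height_tail (nat \<lfloor>c * ln (real n)\<rfloor>) n"
    using eventually_gt_at_top[of 0]
  proof eventually_elim
    case (elim n)
    have "0 \<le> max c 0 * ln n" "c * ln n \<le> max c 0 * ln n"
      using elim by (auto intro!: mult_right_mono)
    then have "real (nat \<lfloor>c * ln (real n)\<rfloor>) \<le> max c 0 * ln n"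
      by linarith
    then have "1 - height_tail (nat \<lfloor>c * ln (real n)\<rfloor>) n \<le> (1 - a) / 2"
      using elim by blast
    then show ?case
      using a by (simp add: field_simps)
  qed
qed


subsection \<open>Binary search trees of concatenated blocks\<close>

text \<open>Counting nodes gives the depth of the leaf at the end of the spine, the place where
  \<open>graft_left\<close> attaches a tree.\<close>

fun left_spine :: "'a tree \<Rightarrow> nat" where
  "left_spine Leaf = 0"
| "left_spine (Node l a r) = Suc (left_spine l)"

fun right_spine :: "'a tree \<Rightarrow> nat" where
  "right_spine Leaf = 0"
| "right_spine (Node l a r) = Suc (right_spine r)"

fun graft_left :: "'a tree \<Rightarrow> 'a tree \<Rightarrow> 'a tree" where
  "graft_left s Leaf = s"
| "graft_left s (Node l a r) = Node (graft_left s l) a r"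

fun graft_right :: "'a tree \<Rightarrow> 'a tree \<Rightarrow> 'a tree" where
  "graft_right s Leaf = s"
| "graft_right s (Node l a r) = Node l a (graft_right s r)"

lemma height_graft_left: "height (graft_left s t) = max (height t) (left_spine t + height s)"
  by (induction t) auto

lemma height_graft_right: "height (graft_right s t) = max (height t) (right_spine t + height s)"
  by (induction t) auto

lemma left_spine_le_height: "left_spine t \<le> height t"
  by (induction t) auto

lemma right_spine_le_height: "right_spine t \<le> height t"
  by (induction t) auto

lemma fold_bst_insert_Node:
  "fold bst_insert zs (Node l a r) =
     Node (fold bst_insert (filter (\<lambda>z. z < a) zs) l) a (fold bst_insert (filter (\<lambda>z. a < z) zs) r)"
  by (induction zs arbitrary: l r) auto

lemma bst_of_list_Nil [simp]: "bst_of_list [] = Leaf"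
  by (simp add: bst_of_list_def)

lemma bst_of_list_Cons:
  "bst_of_list (x # xs) =
     Node (bst_of_list (filter (\<lambda>z. z < x) xs)) x (bst_of_list (filter (\<lambda>z. x < z) xs))"
  by (simp add: bst_of_list_def fold_bst_insert_Node)

lemma bst_of_list_eq_Leaf_iff [simp]: "bst_of_list xs = Leaf \<longleftrightarrow> xs = []"
  by (cases xs) (auto simp: bst_of_list_Cons)

lemma set_bst_insert: "set_tree (bst_insert x t) = insert x (set_tree t)"
  by (induction t) auto

lemma set_bst_of_list: "set_tree (bst_of_list xs) = set xs"
proof -
  have "set_tree (fold bst_insert xs t) = set xs \<union> set_tree t" for t
    by (induction xs arbitrary: t) (auto simp: set_bst_insert)
  then show ?thesis
    by (simp add: bst_of_list_def)
qed

lemma bst_of_list_map: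
  assumes "strict_mono f"
  shows "bst_of_list (map f xs) = map_tree f (bst_of_list xs)"
proof -
  have ins: "bst_insert (f x) (map_tree f t) = map_tree f (bst_insert x t)" for x t
    using assms by (induction t) (auto simp: strict_mono_less)
  have "fold bst_insert (map f xs) (map_tree f t) = map_tree f (fold bst_insert xs t)" for t
    by (induction xs arbitrary: t) (auto simp: ins)
  from this[of Leaf] show ?thesis
    by (simp add: bst_of_list_def)
qed

lemma left_spine_map_tree [simp]: "left_spine (map_tree f t) = left_spine t"
  by (induction t) auto

lemma right_spine_map_tree [simp]: "right_spine (map_tree f t) = right_spine t"
  by (induction t) auto

text \<open>The new keys go left at every node they meet, so they travel together down the left
  spine and build their own tree at its end.\<close>

lemma fold_bst_insert_less:
  assumes "\<And>z x. z \<in> set zs \<Longrightarrow> x \<in> set_tree t \<Longrightarrow> z < x"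
  shows "fold bst_insert zs t = graft_left (bst_of_list zs) t"
  using assms
proof (induction t)
  case (Node l a r)
  then have "filter (\<lambda>z. z < a) zs = zs" "filter (\<lambda>z. a < z) zs = []"
    by (force simp: filter_id_conv filter_empty_conv)+
  with Node show ?case
    by (simp add: fold_bst_insert_Node)
qed (simp add: bst_of_list_def)

lemma fold_bst_insert_greater:
  assumes "\<And>z x. z \<in> set zs \<Longrightarrow> x \<in> set_tree t \<Longrightarrow> x < z"
  shows "fold bst_insert zs t = graft_right (bst_of_list zs) t"
  using assms
proof (induction t)
  case (Node l a r)
  then have "filter (\<lambda>z. a < z) zs = zs" "filter (\<lambda>z. z < a) zs = []"
    by (force simp: filter_id_conv filter_empty_conv)+
  with Node show ?case
    by (simp add: fold_bst_insert_Node)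
qed (simp add: bst_of_list_def)

text \<open>No later key falls between two keys of \<open>xs\<close>, so comparison with the root
  \<open>hd xs\<close> decides on which of the two spines it descends.\<close>

lemma height_bst_of_list_append:
  assumes "xs \<noteq> []"
    and "\<And>z. z \<in> set zs \<Longrightarrow> (\<forall>x\<in>set xs. z < x) \<or> (\<forall>x\<in>set xs. x < z)"
  shows "height (bst_of_list (xs @ zs)) =
    max (height (bst_of_list xs))
      (max (left_spine (bst_of_list xs) + height (bst_of_list (filter (\<lambda>z. z < hd xs) zs)))
        (right_spine (bst_of_list xs) + height (bst_of_list (filter (\<lambda>z. hd xs < z) zs))))"
proof -
  obtain l r where t: "bst_of_list xs = Node l (hd xs) r"
    using assms(1) by (cases xs) (auto simp: bst_of_list_Cons)
  then have set: "set xs = insert (hd xs) (set_tree l \<union> set_tree r)"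
    using set_bst_of_list[of xs] by auto
  have "bst_of_list (xs @ zs) = fold bst_insert zs (Node l (hd xs) r)"
    by (simp add: bst_of_list_def flip: t)
  also have "\<dots> = Node (graft_left (bst_of_list (filter (\<lambda>z. z < hd xs) zs)) l) (hd xs)
      (graft_right (bst_of_list (filter (\<lambda>z. hd xs < z) zs)) r)"
    unfolding fold_bst_insert_Node
  proof (intro arg_cong3[of _ _ _ _ _ _ Node] refl)
    show "fold bst_insert (filter (\<lambda>z. z < hd xs) zs) l =
        graft_left (bst_of_list (filter (\<lambda>z. z < hd xs) zs)) l"
      using assms(2) unfolding set by (intro fold_bst_insert_less) (auto dest: less_asym)
    show "fold bst_insert (filter (\<lambda>z. hd xs < z) zs) r =
        graft_right (bst_of_list (filter (\<lambda>z. hd xs < z) zs)) r"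
      using assms(2) unfolding set by (intro fold_bst_insert_greater) (auto dest: less_asym)
  qed
  finally show ?thesis
    by (simp add: t height_graft_left height_graft_right)
qed

text \<open>The blow-up, without probability. A path with \<open>H\<close> nodes in the tree of
  \<open>ys\<close> has \<open>H - 1\<close> edges; each costs a spine of the block it leaves, and
  the last block adds its height. The recursion goes through the filtered lists of the two
  subtrees.\<close>

lemma height_bst_of_list_blocks:
  fixes B :: "nat \<Rightarrow> 'b::linorder list" and a\<^sub>1 a\<^sub>2 h\<^sub>1 h\<^sub>2 :: real
  assumes "distinct ys" "ys \<noteq> []"
    and "\<And>u. u \<in> set ys \<Longrightarrow> B u \<noteq> []"
    and "\<And>u v x y. u \<in> set ys \<Longrightarrow> v \<in> set ys \<Longrightarrow> u < v \<Longrightarrow> x \<in> set (B u) \<Longrightarrow> y \<in> set (B v) \<Longrightarrow> x < y"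
    and "\<And>u. u \<in> set ys \<Longrightarrow> left_spine (bst_of_list (B u)) \<in> {a\<^sub>1..a\<^sub>2}"
    and "\<And>u. u \<in> set ys \<Longrightarrow> right_spine (bst_of_list (B u)) \<in> {a\<^sub>1..a\<^sub>2}"
    and "\<And>u. u \<in> set ys \<Longrightarrow> height (bst_of_list (B u)) \<in> {h\<^sub>1..h\<^sub>2}"
  shows "height (bst_of_list (concat (map B ys))) \<in>
    {(real (height (bst_of_list ys)) - 1) * a\<^sub>1 + h\<^sub>1..(real (height (bst_of_list ys)) - 1) * a\<^sub>2 + h\<^sub>2}"
  using assms
proof (induction "length ys" arbitrary: ys rule: less_induct)
  case less
  then obtain y zs where ys: "ys = y # zs"
    by (cases ys) auto
  define zl zr where "zl = filter (\<lambda>z. z < y) zs" and "zr = filter (\<lambda>z. y < z) zs"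
  define t where "t = bst_of_list (B y)"
  define HL HR where "HL = height (bst_of_list zl)" and "HR = height (bst_of_list zr)"
  define hL hR where "hL = height (bst_of_list (concat (map B zl)))"
    and "hR = height (bst_of_list (concat (map B zr)))"
  define H where "H = height (bst_of_list ys)"
  have H: "H = Suc (max HL HR)"
    by (simp add: H_def ys bst_of_list_Cons HL_def HR_def zl_def zr_def)
  have y: "hd (B y) \<in> set (B y)"
    using less.prems(3)[of y] ys by simp
  have filt: "filter (\<lambda>z. z < hd (B y)) (concat (map B zs)) = concat (map B zl)"
    "filter (\<lambda>z. hd (B y) < z) (concat (map B zs)) = concat (map B zr)"
  proof -
    \<comment> \<open>Blocks are never cut: all of \<open>B u\<close> lies on the same side of
      \<open>hd (B y)\<close> as \<open>u\<close> of \<open>y\<close>.\<close>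
    have "filter (\<lambda>z. z < hd (B y)) (concat (map B us)) = concat (map B (filter (\<lambda>z. z < y) us))
      \<and> filter (\<lambda>z. hd (B y) < z) (concat (map B us)) = concat (map B (filter (\<lambda>z. y < z) us))"
      if "set us \<subseteq> set zs" for us
      using that
    proof (induction us)
      case (Cons u us)
      then have u: "u \<in> set ys" "u \<noteq> y"
        using less.prems(1) ys by auto
      show ?case
      proof (cases "u < y")
        case True
        then have "\<forall>x\<in>set (B u). x < hd (B y)"
          using less.prems(4)[of u y] u y ys by auto
        then show ?thesis
          using Cons True by (auto simp: filter_id_conv filter_empty_conv dest: less_asym)
      next
        case False
        then have "\<forall>x\<in>set (B u). hd (B y) < x"
          using less.prems(4)[of y u] u y ys by auto
        then show ?thesis
          using Cons False u by (auto simp: filter_id_conv filter_empty_conv dest: less_asym)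
      qed
    qed simp
    from this[of zs] show "filter (\<lambda>z. z < hd (B y)) (concat (map B zs)) = concat (map B zl)"
      "filter (\<lambda>z. hd (B y) < z) (concat (map B zs)) = concat (map B zr)"
      by (simp_all add: zl_def zr_def)
  qed
  have "height (bst_of_list (B y @ concat (map B zs))) =
      max (height t) (max (left_spine t + hL) (right_spine t + hR))"
    unfolding t_def hL_def hR_def filt[symmetric]
  proof (rule height_bst_of_list_append)
    fix z assume "z \<in> set (concat (map B zs))"
    then obtain u where u: "u \<in> set zs" "z \<in> set (B u)"
      by auto
    then have "u < y \<or> y < u"
      using less.prems(1) ys by (cases u y rule: linorder_cases) auto
    then show "(\<forall>x\<in>set (B y). z < x) \<or> (\<forall>x\<in>set (B y). x < z)"
      using less.prems(4)[of u y] less.prems(4)[of y u] u ys by auto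
  qed (use less.prems(3) ys in simp)
  then have height: "height (bst_of_list (concat (map B ys))) =
      max (height t) (max (left_spine t + hL) (right_spine t + hR))"
    by (simp add: ys)
  have t: "left_spine t \<in> {a\<^sub>1..a\<^sub>2}" "right_spine t \<in> {a\<^sub>1..a\<^sub>2}" "height t \<in> {h\<^sub>1..h\<^sub>2}"
    using less.prems ys by (simp_all add: t_def)
  have IH: "real (height (bst_of_list (concat (map B us)))) \<in>
      {(real (height (bst_of_list us)) - 1) * a\<^sub>1 + h\<^sub>1..(real (height (bst_of_list us)) - 1) * a\<^sub>2 + h\<^sub>2}"
    if "us = filter P zs" "us \<noteq> []" for P us
  proof (rule less.hyps)
    have sub: "u \<in> set ys" if "u \<in> set us" for u
      using that \<open>us = filter P zs\<close> ys by auto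
    show "length us < length ys" "distinct us"
      using that less.prems(1) by (auto simp: ys less_Suc_eq_le)
    fix u v x y assume *: "u \<in> set us" "v \<in> set us" "u < v" "x \<in> set (B u)" "y \<in> set (B v)"
    then show "x < y"
      using less.prems(4)[of u v x y] sub by blast
  qed (use that less.prems(3,5,6,7) ys in auto)
  \<comment> \<open>An empty side is kept apart, since the formula at \<open>HL = 0\<close> would
    give \<open>h - a\<close> instead of the true height 0.\<close>
  have L: "zl = [] \<and> HL = 0 \<and> hL = 0 \<or>
      HL > 0 \<and> real hL \<in> {(real HL - 1) * a\<^sub>1 + h\<^sub>1..(real HL - 1) * a\<^sub>2 + h\<^sub>2}"
    using IH[OF zl_def] by (cases "zl = []") (auto simp: HL_def hL_def neq0_conv[symmetric] simp del: neq0_conv)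
  have R: "zr = [] \<and> HR = 0 \<and> hR = 0 \<or>
      HR > 0 \<and> real hR \<in> {(real HR - 1) * a\<^sub>1 + h\<^sub>1..(real HR - 1) * a\<^sub>2 + h\<^sub>2}"
    using IH[OF zr_def] by (cases "zr = []") (auto simp: HR_def hR_def neq0_conv[symmetric] simp del: neq0_conv)
  have a2: "a\<^sub>2 \<ge> 0"
    using t(1) by auto
  have le: "real HL * a\<^sub>2 \<le> real (H - 1) * a\<^sub>2" "real HR * a\<^sub>2 \<le> real (H - 1) * a\<^sub>2"
    using a2 unfolding H by (intro mult_right_mono; simp)+
  \<comment> \<open>On an empty side only the spine remains, and it is at most
    \<open>height t\<close>, hence at most \<open>h\<^sub>2\<close>.\<close>
  have upper: "real (s + k) \<le> real (H - 1) * a\<^sub>2 + h\<^sub>2"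
    if "K = 0 \<and> k = 0 \<or> K > 0 \<and> real k \<in> {(real K - 1) * a\<^sub>1 + h\<^sub>1..(real K - 1) * a\<^sub>2 + h\<^sub>2}"
      "real s \<in> {a\<^sub>1..a\<^sub>2}" "s \<le> height t" "real K * a\<^sub>2 \<le> real (H - 1) * a\<^sub>2" for s k K
  proof -
    have "0 \<le> real (H - 1) * a\<^sub>2" "real s \<le> h\<^sub>2"
      using a2 that(3) t(3) by auto
    with that show ?thesis
      unfolding atLeastAtMost_iff left_diff_distrib by linarith
  qed
  have "real (height t) \<le> real (H - 1) * a\<^sub>2 + h\<^sub>2"
  proof -
    have "0 \<le> real (H - 1) * a\<^sub>2"
      using a2 by simp
    then show ?thesis
      using t(3) unfolding atLeastAtMost_iff by linarith
  qed
  moreover have "real (left_spine t + hL) \<le> real (H - 1) * a\<^sub>2 + h\<^sub>2"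
    using L t(1) left_spine_le_height le(1) by (intro upper) auto
  moreover have "real (right_spine t + hR) \<le> real (H - 1) * a\<^sub>2 + h\<^sub>2"
    using R t(2) right_spine_le_height le(2) by (intro upper) auto
  ultimately have "real (max (height t) (max (left_spine t + hL) (right_spine t + hR))) \<le> real (H - 1) * a\<^sub>2 + h\<^sub>2"
    by (auto simp: max_def)
  moreover have "real (H - 1) * a\<^sub>1 + h\<^sub>1 \<le> real (max (height t) (max (left_spine t + hL) (right_spine t + hR)))"
  proof -
    have lower: "real K * a\<^sub>1 + h\<^sub>1 \<le> real (s + k)"
      if "K > 0 \<and> real k \<in> {(real K - 1) * a\<^sub>1 + h\<^sub>1..(real K - 1) * a\<^sub>2 + h\<^sub>2}"
        "real s \<in> {a\<^sub>1..a\<^sub>2}" for s k K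
      using that unfolding atLeastAtMost_iff left_diff_distrib by simp
    \<comment> \<open>The lower bound follows a taller side, whose height is exactly
      \<open>H - 1\<close>; if both sides are empty, the block \<open>B y\<close> alone
      suffices.\<close>
    consider "H - 1 = 0" | "H - 1 = HL" "HL > 0" | "H - 1 = HR" "HR > 0"
      unfolding H by (cases "HL \<le> HR"; cases "HL = 0"; cases "HR = 0") auto
    then show ?thesis
    proof cases
      case 1
      then show ?thesis
        unfolding 1 of_nat_max using t(3) by (simp add: le_max_iff_disj)
    next
      case 2
      then have "real (H - 1) * a\<^sub>1 + h\<^sub>1 \<le> real (left_spine t + hL)"
        using L t(1) by (simp only:) (intro lower, auto)
      then show ?thesis
        unfolding of_nat_max by (simp add: le_max_iff_disj)
    next
      case 3
      then have "real (H - 1) * a\<^sub>1 + h\<^sub>1 \<le> real (right_spine t + hR)"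
        using R t(2) by (simp only:) (intro lower, auto)
      then show ?thesis
        unfolding of_nat_max by (simp add: le_max_iff_disj)
    qed
  qed
  moreover have H1: "real H - 1 = real (H - 1)"
    by (simp add: H)
  ultimately show ?case
    unfolding height H_def[symmetric] H1 atLeastAtMost_iff by blast
qed


subsection \<open>Random binary search trees\<close>

text \<open>Keys from an interval keep the recursion closed: both subtrees of a root have intervals
  of keys, without relabelling.\<close>

definition random_bst :: "nat \<Rightarrow> nat \<Rightarrow> nat tree pmf" where
  "random_bst a b = map_pmf bst_of_list (pmf_of_set (permutations_of_set {a..<b}))"

lemma finite_set_random_bst [simp]: "finite (set_pmf (random_bst a b))"
  by (simp add: random_bst_def)

lemma random_bst_empty: "b \<le> a \<Longrightarrow> random_bst a b = return_pmf Leaf"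
  by (simp add: random_bst_def pmf_of_set_singleton)

text \<open>The first key is uniform, and given it the smaller and the larger keys form independent
  uniform permutations.\<close>

lemma random_bst_rec:
  assumes "a < b"
  shows "random_bst a b = pmf_of_set {a..<b} \<bind> (\<lambda>x. map_pmf (\<lambda>(l, r). Node l x r)
           (pair_pmf (random_bst a x) (random_bst (Suc x) b)))"
proof -
  have "random_bst a b = pmf_of_set {a..<b} \<bind> (\<lambda>x.
      map_pmf (\<lambda>xs. bst_of_list (x # xs)) (pmf_of_set (permutations_of_set ({a..<b} - {x}))))"
    unfolding random_bst_def using assms
    by (subst random_permutation_of_set) (auto simp: map_bind_pmf map_pmf_def bind_assoc_pmf bind_return_pmf)
  also have "\<dots> = pmf_of_set {a..<b} \<bind> (\<lambda>x. map_pmf (\<lambda>(l, r). Node l x r)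
           (pair_pmf (random_bst a x) (random_bst (Suc x) b)))"
  proof (intro bind_pmf_cong refl)
    fix x assume "x \<in> set_pmf (pmf_of_set {a..<b})"
    then have x: "x \<in> {a..<b}"
      using assms by (subst (asm) set_pmf_of_set) auto
    let ?P = "pmf_of_set (permutations_of_set ({a..<b} - {x}))"
    have "map_pmf (\<lambda>xs. bst_of_list (x # xs)) ?P = map_pmf (\<lambda>(l, r). Node (bst_of_list l) x (bst_of_list r))
        (map_pmf (List.partition (\<lambda>y. y < x)) ?P)"
    proof (unfold map_pmf_comp, intro map_pmf_cong refl)
      fix xs assume "xs \<in> set_pmf ?P"
      then have "xs \<in> permutations_of_set ({a..<b} - {x})"
        by simp
      then have "x \<notin> set xs"
        using permutations_of_setD(1) by blast
      then have "filter (\<lambda>y. x < y) xs = filter (\<lambda>y. \<not> y < x) xs"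
        by (intro filter_cong) (auto simp: not_less order_le_less)
      then show "bst_of_list (x # xs) =
          (case List.partition (\<lambda>y. y < x) xs of (l, r) \<Rightarrow> Node (bst_of_list l) x (bst_of_list r))"
        by (simp add: bst_of_list_Cons o_def)
    qed
    also have "map_pmf (List.partition (\<lambda>y. y < x)) ?P =
        pair_pmf (pmf_of_set (permutations_of_set {a..<x})) (pmf_of_set (permutations_of_set {Suc x..<b}))"
    proof -
      have "{y \<in> {a..<b} - {x}. y < x} = {a..<x}" "{y \<in> {a..<b} - {x}. \<not> y < x} = {Suc x..<b}"
        using x by auto
      then show ?thesis
        by (subst partition_random_permutations) auto
    qed
    also have "map_pmf (\<lambda>(l, r). Node (bst_of_list l) x (bst_of_list r)) \<dots> =
        map_pmf (\<lambda>(l, r). Node l x r) (pair_pmf (random_bst a x) (random_bst (Suc x) b))"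
      unfolding random_bst_def map_pair[symmetric] map_pmf_comp by (simp add: case_prod_unfold)
    finally show "map_pmf (\<lambda>xs. bst_of_list (x # xs)) ?P =
        map_pmf (\<lambda>(l, r). Node l x r) (pair_pmf (random_bst a x) (random_bst (Suc x) b))" .
  qed
  finally show ?thesis .
qed

lemma measure_pair_pmf_Times:
  "measure_pmf.prob (pair_pmf p q) (A \<times> B) = measure_pmf.prob p A * measure_pmf.prob q B"
proof -
  have "measure_pmf.prob (pair_pmf p q) (A \<times> B) =
      pmf (map_pmf (\<lambda>(x, y). (x \<in> A, y \<in> B)) (pair_pmf p q)) (True, True)"
  proof -
    have "A \<times> B = (\<lambda>(x, y). (x \<in> A, y \<in> B)) -` {(True, True)}"
      by auto
    then show ?thesis
      by (simp add: pmf_map)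
  qed
  also have "\<dots> = measure_pmf.prob p A * measure_pmf.prob q B"
    by (simp add: map_pair pmf_pair pmf_map vimage_def)
  finally show ?thesis .
qed

lemma expectation_random_bst_rec:
  fixes f :: "nat tree \<Rightarrow> real"
  assumes "a < b"
  shows "measure_pmf.expectation (random_bst a b) f = (\<Sum>x\<in>{a..<b}.
    measure_pmf.expectation (pair_pmf (random_bst a x) (random_bst (Suc x) b)) (\<lambda>(l, r). f (Node l x r))) / (b - a)"
  using assms
  by (subst random_bst_rec) (auto simp: pmf_expectation_bind_pmf_of_set case_prod_unfold divide_inverse
        sum_distrib_left of_nat_diff mult.commute intro!: sum.cong)

lemma sum_split_shift:
  fixes a b :: nat
  shows "(\<Sum>x\<in>{a..<b}. g (x - a) (b - Suc x)) = (\<Sum>u<b - a. g u (b - a - 1 - u))"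
  by (rule sum.reindex_bij_witness[of _ "\<lambda>u. u + a" "\<lambda>x. x - a"]) (auto intro: arg_cong2[of _ _ _ _ g])

text \<open>Height at most \<open>j + 1\<close> means that both independent subtrees have height at
  most \<open>j\<close>; the complement of this recursion is \<open>branch\<close>.\<close>

lemma prob_height_le:
  "measure_pmf.prob (random_bst a b) {t. height t \<le> j} = 1 - height_tail j (b - a)"
proof (induction j arbitrary: a b)
  case 0
  show ?case
  proof (cases "a < b")
    case True
    then have "Leaf \<notin> set_pmf (random_bst a b)"
      by (auto simp: random_bst_def dest!: sym[of Leaf] permutations_of_setD(1))
    then have "measure_pmf.prob (random_bst a b) {t. height t \<le> 0} = 0"
      by (subst measure_pmf_zero_iff) auto
    then show ?thesis
      using True by (simp add: height_tail_0)
  next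
    case False
    then show ?thesis
      by (simp add: height_tail_0 random_bst_empty)
  qed
next
  case (Suc j)
  show ?case
  proof (cases "a < b")
    case True
    have "measure_pmf.prob (random_bst a b) {t. height t \<le> Suc j} =
        measure_pmf.expectation (random_bst a b) (indicator {t. height t \<le> Suc j})"
      by simp
    also have "\<dots> = (\<Sum>x\<in>{a..<b}. measure_pmf.prob (pair_pmf (random_bst a x) (random_bst (Suc x) b))
        ({t. height t \<le> j} \<times> {t. height t \<le> j})) / (b - a)"
    proof -
      have "(\<lambda>(l, r). indicator {t. height t \<le> Suc j} (Node l x r)) =
          (indicator ({t. height t \<le> j} \<times> {t. height t \<le> j}) :: _ \<Rightarrow> real)" for x :: nat
        by (auto simp: indicator_def fun_eq_iff)
      then show ?thesis
        unfolding expectation_random_bst_rec[OF True] by simp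
    qed
    also have "\<dots> = (\<Sum>x\<in>{a..<b}. (1 - height_tail j (x - a)) * (1 - height_tail j (b - Suc x))) / (b - a)"
      by (simp only: measure_pair_pmf_Times Suc.IH)
    also have "\<dots> = (\<Sum>u<b - a. (1 - height_tail j u) * (1 - height_tail j (b - a - 1 - u))) / (b - a)"
      by (subst sum_split_shift) (rule refl)
    also have "\<dots> = (\<Sum>u<b - a. 1 - (height_tail j u + height_tail j (b - a - 1 - u)
        - height_tail j u * height_tail j (b - a - 1 - u))) / real (b - a)"
      using True by (simp add: of_nat_diff algebra_simps)
    also have "\<dots> = 1 - height_tail (Suc j) (b - a)"
      using True unfolding height_tail_Suc branch_def sum_subtractf by (simp add: diff_divide_distrib)
    finally show ?thesis .
  next
    case False
    then show ?thesis
      by (simp add: height_tail_Suc branch_def random_bst_empty)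
  qed
qed

text \<open>The generating function of the number of records of a random permutation: a product over
  independent Bernoulli variables with means \<open>1 / (i + 1)\<close>.\<close>

definition spine_gf :: "real \<Rightarrow> nat \<Rightarrow> real" where
  "spine_gf z n = (\<Prod>i<n. 1 + (z - 1) / real (Suc i))"

text \<open>The recursion of a spine: one node for the root plus the spine of a subtree of uniform
  size.\<close>

lemma sum_spine_gf: "z * (\<Sum>u<n. spine_gf z u) = n * spine_gf z n"
  by (induction n) (simp_all add: spine_gf_def field_simps)

text \<open>From \<open>1 + x \<le> exp x\<close> in each factor, on either side of
  \<open>z = 1\<close>; one bound thus serves both tails.\<close>

lemma spine_gf_le:
  assumes "z > 0"
  shows "spine_gf z n \<le> exp ((z - 1) * harm n)"
proof -
  have "spine_gf z n \<le> (\<Prod>i<n. exp ((z - 1) / real (Suc i)))"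
    unfolding spine_gf_def using assms
    by (intro prod_mono conjI exp_ge_add_one_self) (auto simp: field_simps)
  also have "\<dots> = exp ((z - 1) * harm n)"
    by (simp add: exp_sum[symmetric] harm_altdef sum_distrib_left divide_inverse)
  finally show ?thesis .
qed

lemma expectation_left_spine:
  "measure_pmf.expectation (random_bst a b) (\<lambda>t. z ^ left_spine t) = spine_gf z (b - a)"
proof (induction "b - a" arbitrary: a b rule: less_induct)
  case less
  show ?case
  proof (cases "a < b")
    case True
    have "measure_pmf.expectation (random_bst a b) (\<lambda>t. z ^ left_spine t) =
        (\<Sum>x\<in>{a..<b}. z * measure_pmf.expectation (random_bst a x) (\<lambda>t. z ^ left_spine t)) / (b - a)"
      unfolding expectation_random_bst_rec[OF True]
      by (simp add: case_prod_unfold expectation_pair_pmf_fst[of _ _ "\<lambda>t. z ^ left_spine t"])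
    also have "\<dots> = (\<Sum>x\<in>{a..<b}. z * spine_gf z (x - a)) / (b - a)"
      using less by (intro arg_cong2[of _ _ _ _ "(/)"] sum.cong) auto
    also have "\<dots> = spine_gf z (b - a)"
      using sum_spine_gf[of z "b - a"] sum_split_shift[of "\<lambda>u v. z * spine_gf z u" a b] True
      by (simp add: of_nat_diff sum_distrib_left)
    finally show ?thesis .
  qed (simp add: spine_gf_def random_bst_empty)
qed

lemma expectation_right_spine:
  "measure_pmf.expectation (random_bst a b) (\<lambda>t. z ^ right_spine t) = spine_gf z (b - a)"
proof (induction "b - a" arbitrary: a b rule: less_induct)
  case less
  show ?case
  proof (cases "a < b")
    case True
    have "measure_pmf.expectation (random_bst a b) (\<lambda>t. z ^ right_spine t) =
        (\<Sum>x\<in>{a..<b}. z * measure_pmf.expectation (random_bst (Suc x) b) (\<lambda>t. z ^ right_spine t)) / (b - a)"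
      unfolding expectation_random_bst_rec[OF True]
      by (simp add: case_prod_unfold expectation_pair_pmf_snd[of _ _ "\<lambda>t. z ^ right_spine t"])
    also have "\<dots> = (\<Sum>x\<in>{a..<b}. z * spine_gf z (b - Suc x)) / (b - a)"
      using less by (intro arg_cong2[of _ _ _ _ "(/)"] sum.cong) auto
    also have "\<dots> = spine_gf z (b - a)"
      using sum_spine_gf[of z "b - a"] sum_split_shift[of "\<lambda>u v. z * spine_gf z v" a b] True
        sum_rev_lessThan[of "\<lambda>u. z * spine_gf z u" "b - a"]
      by (simp add: of_nat_diff sum_distrib_left)
    finally show ?thesis .
  qed (simp add: spine_gf_def random_bst_empty)
qed

text \<open>Chernoff bound: for \<open>z > 1\<close> the event is \<open>s t \<ge> z * ln n\<close>, for \<open>z < 1\<close> it is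
  \<open>s t \<le> z * ln n\<close>.\<close>

lemma spine_large_deviation:
  fixes s :: "nat tree \<Rightarrow> nat"
  assumes gf: "\<And>n. measure_pmf.expectation (random_bst 0 n) (\<lambda>t. z ^ s t) = spine_gf z n"
    and z: "z > 0" "z \<noteq> 1"
  shows "(\<lambda>n. measure_pmf.prob (random_bst 0 n) {t. s t * ln z \<ge> z * ln n * ln z}) \<longlonglongrightarrow> 0"
proof -
  \<comment> \<open>The Poisson large deviation rate at \<open>z\<close> times the mean.\<close>
  define \<kappa> where "\<kappa> = z * ln z - (z - 1)"
  have "\<kappa> > 0"
  proof -
    have "ln (1 / z) < 1 / z - 1"
      using ln_le_minus_one[of "1 / z"] ln_eq_minus_one[of "1 / z"] z by fastforce
    then show ?thesis
      using z by (simp add: \<kappa>_def ln_div field_simps)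
  qed
  show ?thesis
  proof (rule tendsto_sandwich[OF _ _ tendsto_const])
    show "eventually (\<lambda>n. measure_pmf.prob (random_bst 0 n) {t. s t * ln z \<ge> z * ln n * ln z}
        \<le> exp \<bar>z - 1\<bar> * real n powr (- \<kappa>)) sequentially"
      using eventually_gt_at_top[of 0]
    proof eventually_elim
      case (elim n)
      define X where "X = {t::nat tree. s t * ln z \<ge> z * ln n * ln z}"
      \<comment> \<open>The sign of \<open>z - 1\<close> decides whether an upper or a lower bound
        for the harmonic number is needed.\<close>
      have harm: "(z - 1) * harm n \<le> (z - 1) * ln n + \<bar>z - 1\<bar>"
      proof (cases "z > 1")
        case True
        have "harm n - ln (real n) \<le> 1"
          using decseqD[OF decseq_harm_diff_ln, of 0 "n - 1"] elim by (simp add: harm_expand)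
        then have "(z - 1) * (harm n - ln (real n)) \<le> (z - 1) * 1"
          using True by (intro mult_left_mono) auto
        then show ?thesis
          using True by (simp add: algebra_simps)
      next
        case False
        have "ln (real n) \<le> ln (real n + 1)"
          using elim by simp
        also have "\<dots> \<le> harm n"
          by (rule harm_ge_ln)
        finally have "(1 - z) * ln (real n) \<le> (1 - z) * harm n"
          using False by (intro mult_left_mono) auto
        then show ?thesis
          by (simp add: algebra_simps)
      qed
      have "measure_pmf.prob (random_bst 0 n) X * exp (z * ln n * ln z) =
          measure_pmf.expectation (random_bst 0 n) (\<lambda>t. indicator X t * exp (z * ln n * ln z))"
        by simp
      also have "\<dots> \<le> measure_pmf.expectation (random_bst 0 n) (\<lambda>t. z ^ s t)"
      proof (intro integral_mono integrable_measure_pmf_finite finite_set_random_bst)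
        fix t
        have pow: "exp (s t * ln z) = z ^ s t"
          using z by (simp add: exp_of_nat_mult)
        show "indicator X t * exp (z * ln n * ln z) \<le> z ^ s t"
        proof (cases "t \<in> X")
          case True
          then have "exp (z * ln n * ln z) \<le> exp (s t * ln z)"
            by (simp add: X_def)
          then show ?thesis
            using True pow by simp
        qed (use z in simp)
      qed
      also have "\<dots> \<le> exp ((z - 1) * ln n + \<bar>z - 1\<bar>)"
        unfolding gf using spine_gf_le[OF z(1), of n] harm by (meson exp_le_cancel_iff order_trans)
      finally have "measure_pmf.prob (random_bst 0 n) X \<le>
          exp ((z - 1) * ln n + \<bar>z - 1\<bar>) / exp (z * ln n * ln z)"
        by (simp add: field_simps)
      also have "\<dots> = exp (\<bar>z - 1\<bar>) * real n powr (- \<kappa>)"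
        using elim by (simp add: powr_def \<kappa>_def algebra_simps flip: exp_diff exp_add)
      finally show ?case
        by (simp add: X_def)
    qed
    show "(\<lambda>n. exp \<bar>z - 1\<bar> * real n powr (- \<kappa>)) \<longlonglongrightarrow> 0"
      using \<open>\<kappa> > 0\<close> by real_asymp
  qed simp
qed

definition typical_tree :: "real \<Rightarrow> real \<Rightarrow> 'a tree \<Rightarrow> bool" where
  "typical_tree \<epsilon> L t \<longleftrightarrow>
     real (left_spine t) \<in> {(1 - \<epsilon>) * L..(1 + \<epsilon>) * L} \<and>
     real (right_spine t) \<in> {(1 - \<epsilon>) * L..(1 + \<epsilon>) * L} \<and>
     real (height t) \<in> {(c_star - \<epsilon>) * L..(c_star + \<epsilon>) * L}"

lemma random_bst_typical:
  assumes "0 < \<epsilon>" "\<epsilon> < 1"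
  shows "(\<lambda>n. measure_pmf.prob (random_bst 0 n) {t. \<not> typical_tree \<epsilon> (ln n) t}) \<longlonglongrightarrow> 0"
proof -
  define X where "X = (\<lambda>(s::nat tree \<Rightarrow> nat) z (n::nat). {t. s t * ln z \<ge> z * ln n * ln z})"
  define U where "U = (\<lambda>n::nat. {t::nat tree. height t \<le> nat \<lfloor>(c_star - \<epsilon>) * ln n\<rfloor>})"
  define V where "V = (\<lambda>n::nat. {t::nat tree. height t \<le> nat \<lfloor>(c_star + \<epsilon>) * ln n\<rfloor>})"
  let ?P = "\<lambda>n. measure_pmf.prob (random_bst 0 n)"
  define f where "f = (\<lambda>n. ?P n (X left_spine (1 + \<epsilon>) n) + ?P n (X left_spine (1 - \<epsilon>) n)
     + ?P n (X right_spine (1 + \<epsilon>) n) + ?P n (X right_spine (1 - \<epsilon>) n)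
     + ?P n (U n) + ?P n (- V n))"
  show ?thesis
  proof (rule tendsto_sandwich[OF _ _ tendsto_const])
    show "eventually (\<lambda>n. ?P n {t. \<not> typical_tree \<epsilon> (ln n) t} \<le> f n) sequentially"
      using eventually_gt_at_top[of 0]
    proof eventually_elim
      case (elim n)
      have "{t. \<not> typical_tree \<epsilon> (ln n) t} \<subseteq> X left_spine (1 + \<epsilon>) n \<union> X left_spine (1 - \<epsilon>) n
          \<union> X right_spine (1 + \<epsilon>) n \<union> X right_spine (1 - \<epsilon>) n \<union> U n \<union> - V n"
      proof
        fix t :: "nat tree" assume t: "t \<in> {t. \<not> typical_tree \<epsilon> (ln n) t}"
        \<comment> \<open>These signs turn the events \<open>X\<close> into an upper and a lower
          tail.\<close>
        have "ln (1 + \<epsilon>) > 0" "ln (1 - \<epsilon>) < 0"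
          using assms by auto
        then have X: "t \<in> X s (1 + \<epsilon>) n \<longleftrightarrow> (1 + \<epsilon>) * ln n \<le> s t"
          "t \<in> X s (1 - \<epsilon>) n \<longleftrightarrow> s t \<le> (1 - \<epsilon>) * ln n" for s
          unfolding X_def by auto
        have "t \<in> U n" if "real (height t) < (c_star - \<epsilon>) * ln n"
          using that unfolding U_def mem_Collect_eq by linarith
        moreover have "t \<in> - V n" if "real (height t) > (c_star + \<epsilon>) * ln n"
        proof -
          have "(c_star + \<epsilon>) * ln n \<ge> 0"
            using assms c_star_gt_2 elim by (intro mult_nonneg_nonneg) auto
          then show ?thesis
            using that unfolding V_def mem_Collect_eq Compl_iff by linarith
        qed
        ultimately show "t \<in> X left_spine (1 + \<epsilon>) n \<union> X left_spine (1 - \<epsilon>) n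
          \<union> X right_spine (1 + \<epsilon>) n \<union> X right_spine (1 - \<epsilon>) n \<union> U n \<union> - V n"
          using t by (auto simp: typical_tree_def X not_le)
      qed
      then have "?P n {t. \<not> typical_tree \<epsilon> (ln n) t} \<le> ?P n (X left_spine (1 + \<epsilon>) n \<union> X left_spine (1 - \<epsilon>) n
          \<union> X right_spine (1 + \<epsilon>) n \<union> X right_spine (1 - \<epsilon>) n \<union> U n \<union> - V n)"
        by (intro measure_pmf.finite_measure_mono) auto
      also have "\<dots> \<le> f n"
        unfolding f_def
        by (rule order_trans[OF measure_Un_le add_right_mono]; (simp only: sets_measure_pmf UNIV_I)?)+
      finally show ?case .
    qed
    have "f \<longlonglongrightarrow> 0 + 0 + 0 + 0 + 0 + 0"
      unfolding f_def
    proof (intro tendsto_add)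
      show "(\<lambda>n. ?P n (X left_spine (1 + \<epsilon>) n)) \<longlonglongrightarrow> 0" "(\<lambda>n. ?P n (X left_spine (1 - \<epsilon>) n)) \<longlonglongrightarrow> 0"
        "(\<lambda>n. ?P n (X right_spine (1 + \<epsilon>) n)) \<longlonglongrightarrow> 0" "(\<lambda>n. ?P n (X right_spine (1 - \<epsilon>) n)) \<longlonglongrightarrow> 0"
        unfolding X_def using assms
        by (intro spine_large_deviation; simp add: expectation_left_spine expectation_right_spine)+
      have "(\<lambda>n. 1 - height_tail (nat \<lfloor>(c_star - \<epsilon>) * ln n\<rfloor>) n) \<longlonglongrightarrow> 1 - 1"
        using assms by (intro tendsto_diff tendsto_const height_tail_tendsto_1) auto
      then show "(\<lambda>n. ?P n (U n)) \<longlonglongrightarrow> 0"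
        by (simp add: U_def prob_height_le)
      have "(\<lambda>n. height_tail (nat \<lfloor>(c_star + \<epsilon>) * ln n\<rfloor>) n) \<longlonglongrightarrow> 0"
        using assms by (intro height_tail_tendsto_0) auto
      then show "(\<lambda>n. ?P n (- V n)) \<longlonglongrightarrow> 0"
        using prob_height_le[of 0] measure_pmf.prob_compl[of "V _" "random_bst 0 _"]
        by (simp add: V_def Compl_eq_Diff_UNIV)
    qed
    then show "f \<longlonglongrightarrow> 0"
      by simp
  qed simp
qed


subsection \<open>Wreath and tensor products as block permutations\<close>

lemma perm_mat_eq_iff:
  assumes "\<And>j. j < N \<Longrightarrow> p j < N"
  shows "perm_mat N p = perm_mat N q \<longleftrightarrow> (\<forall>j<N. p j = q j)"
proof
  assume eq: "perm_mat N p = perm_mat N q"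
  show "\<forall>j<N. p j = q j"
  proof (intro allI impI)
    fix j assume j: "j < N"
    have "perm_mat N p $$ (p j, j) = perm_mat N q $$ (p j, j)"
      by (simp add: eq)
    then show "p j = q j"
      using j assms[OF j] by (simp add: perm_mat_def split: if_splits)
  qed
qed (auto simp: perm_mat_def)

lemma perm_mat_mult:
  assumes "\<And>j. j < N \<Longrightarrow> q j < N"
  shows "perm_mat N p * perm_mat N q = perm_mat N (p \<circ> q)"
proof (rule eq_matI)
  fix i j assume "i < dim_row (perm_mat N (p \<circ> q))" "j < dim_col (perm_mat N (p \<circ> q))"
  then have ij: "i < N" "j < N"
    by (auto simp: perm_mat_def)
  have "(perm_mat N p * perm_mat N q) $$ (i, j) =
      (\<Sum>k = 0..<N. (if i = p k then 1 else 0) * (if k = q j then 1 else 0))"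
    using ij by (auto simp: perm_mat_def scalar_prod_def intro!: sum.cong)
  also have "\<dots> = (\<Sum>k = 0..<N. if k = q j then (if i = p k then 1 else 0) else 0)"
    by (rule sum.cong) auto
  also have "\<dots> = perm_mat N (p \<circ> q) $$ (i, j)"
    using ij assms by (simp add: perm_mat_def)
  finally show "(perm_mat N p * perm_mat N q) $$ (i, j) = perm_mat N (p \<circ> q) $$ (i, j)" .
qed (auto simp: perm_mat_def)

lemma eq_block_iff:
  fixes n :: nat
  assumes "k < n"
  shows "i = u * n + k \<longleftrightarrow> i div n = u \<and> i mod n = k"
  using assms by (metis div_mult_mod_eq div_mult_self3 div_less mod_mult_self3 mod_less add_cancel_left_right not_less_zero add.right_neutral)

lemma kronecker_perm_mat:
  assumes "\<And>k. k < n \<Longrightarrow> \<pi> k < n"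
  shows "kronecker (perm_mat m \<rho>) (perm_mat n \<pi>) = perm_mat (n * m) (\<lambda>x. \<rho> (x div n) * n + \<pi> (x mod n))"
proof (rule eq_matI)
  fix i j assume "i < dim_row (perm_mat (n * m) (\<lambda>x. \<rho> (x div n) * n + \<pi> (x mod n)))"
    "j < dim_col (perm_mat (n * m) (\<lambda>x. \<rho> (x div n) * n + \<pi> (x mod n)))"
  then have ij: "i < n * m" "j < n * m"
    by (auto simp: perm_mat_def)
  then have "n > 0"
    by (cases n) auto
  moreover have "i div n < m" "j div n < m"
    using ij by (auto simp: less_mult_imp_div_less mult.commute)
  ultimately show "kronecker (perm_mat m \<rho>) (perm_mat n \<pi>) $$ (i, j) =
      perm_mat (n * m) (\<lambda>x. \<rho> (x div n) * n + \<pi> (x mod n)) $$ (i, j)"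
    using ij eq_block_iff[of "\<pi> (j mod n)" n i "\<rho> (j div n)"] assms[of "j mod n"]
    by (auto simp: kronecker_def perm_mat_def mult.commute)
qed (auto simp: kronecker_def perm_mat_def)

lemma diag_block_perm_mat:
  assumes "\<And>j k. j < m \<Longrightarrow> k < n \<Longrightarrow> \<pi> j k < n"
  shows "diag_block_mat (map (\<lambda>j. perm_mat n (\<pi> j)) [0..<m]) =
    perm_mat (n * m) (\<lambda>x. x div n * n + \<pi> (x div n) (x mod n))"
  using assms
proof (induction m arbitrary: \<pi>)
  case 0
  then show ?case
    by (intro eq_matI) (auto simp: perm_mat_def)
next
  case (Suc m)
  define p where "p = (\<lambda>\<pi> x. x div n * n + \<pi> (x div n) (x mod n) :: nat)"
  have "map (\<lambda>j. perm_mat n (\<pi> j)) [0..<Suc m] = perm_mat n (\<pi> 0) # map (\<lambda>j. perm_mat n (\<pi> (Suc j))) [0..<m]"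
    by (simp add: upt_conv_Cons map_Suc_upt[symmetric] del: upt_Suc)
  moreover have "diag_block_mat (map (\<lambda>j. perm_mat n (\<pi> (Suc j))) [0..<m]) = perm_mat (n * m) (p (\<lambda>j. \<pi> (Suc j)))"
    unfolding p_def by (rule Suc.IH) (use Suc.prems in auto)
  ultimately have "diag_block_mat (map (\<lambda>j. perm_mat n (\<pi> j)) [0..<Suc m]) =
      four_block_mat (perm_mat n (\<pi> 0)) (0\<^sub>m n (n * m)) (0\<^sub>m (n * m) n) (perm_mat (n * m) (p (\<lambda>j. \<pi> (Suc j))))"
    by (simp add: Let_def perm_mat_def del: upt_Suc)
  also have "\<dots> = perm_mat (n * Suc m) (p \<pi>)"
  proof (rule eq_matI)
    fix i j assume "i < dim_row (perm_mat (n * Suc m) (p \<pi>))" "j < dim_col (perm_mat (n * Suc m) (p \<pi>))"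
    then have ij: "i < n + n * m" "j < n + n * m"
      by (auto simp: perm_mat_def)
    then have n: "n > 0"
      by (cases n) auto
    let ?A = "four_block_mat (perm_mat n (\<pi> 0)) (0\<^sub>m n (n * m)) (0\<^sub>m (n * m) n) (perm_mat (n * m) (p (\<lambda>j. \<pi> (Suc j))))"
    show "?A $$ (i, j) = perm_mat (n * Suc m) (p \<pi>) $$ (i, j)"
    proof (cases "j < n")
      case True
      then show ?thesis
        using ij n Suc.prems[of 0 j] by (auto simp: perm_mat_def p_def)
    next
      case False
      define l where "l = j - n"
      have l: "j = n + l" "j div n = Suc (l div n)" "j mod n = l mod n"
        using False n by (auto simp: l_def le_div_geq le_mod_geq)
      show ?thesis
        using ij n l by (auto simp: perm_mat_def p_def)
    qed
  qed (auto simp: perm_mat_def)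
  finally show ?case
    by (simp add: p_def)
qed

text \<open>The inner permutation is indexed by the target block \<open>\<rho> (x div n)\<close>,
  because the block-diagonal factor acts after the Kronecker factor.\<close>

definition block_perm :: "nat \<Rightarrow> nat \<Rightarrow> (nat \<Rightarrow> nat \<Rightarrow> nat) \<Rightarrow> (nat \<Rightarrow> nat) \<Rightarrow> nat \<Rightarrow> nat" where
  "block_perm n m \<pi> \<rho> x = (if x < n * m then \<rho> (x div n) * n + \<pi> (\<rho> (x div n)) (x mod n) else x)"

abbreviation (input) perms :: "nat \<Rightarrow> (nat \<Rightarrow> nat) set" where
  "perms n \<equiv> {p. p permutes {..<n}}"

lemma perms_less: "p \<in> perms n \<Longrightarrow> k < n \<Longrightarrow> p k < n"
  using permutes_in_image[of p "{..<n}" k] by auto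

lemma block_index_less: "i < m \<Longrightarrow> k < n \<Longrightarrow> i * n + k < n * (m::nat)"
proof -
  assume "i < m" "k < n"
  then have "i * n + k < Suc i * n"
    by simp
  also have "\<dots> \<le> m * n"
    using \<open>i < m\<close> by (intro mult_le_mono1) simp
  finally show ?thesis
    by (simp add: mult.commute)
qed

lemma block_perm_index:
  assumes "i < m" "k < n"
  shows "block_perm n m \<pi> \<rho> (i * n + k) = \<rho> i * n + \<pi> (\<rho> i) k"
  using assms block_index_less[OF assms] by (simp add: block_perm_def)

lemma block_index_cases:
  assumes "x < n * (m::nat)"
  obtains i k where "i < m" "k < n" "x = i * n + k"
proof (rule that)
  have "n > 0"
    using assms by (cases n) auto
  then show "x div n < m" "x mod n < n" "x = x div n * n + x mod n"
    using assms by (auto simp: less_mult_imp_div_less mult.commute)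
qed

lemma block_perm_permutes:
  assumes \<pi>: "\<And>j. j < m \<Longrightarrow> \<pi> j \<in> perms n" and \<rho>: "\<rho> \<in> perms m"
  shows "block_perm n m \<pi> \<rho> \<in> perms (n * m)"
proof -
  have sub: "block_perm n m \<pi> \<rho> ` {..<n * m} \<subseteq> {..<n * m}"
  proof
    fix y assume "y \<in> block_perm n m \<pi> \<rho> ` {..<n * m}"
    then obtain x where x: "x < n * m" "y = block_perm n m \<pi> \<rho> x"
      by auto
    from x(1) obtain i k where "i < m" "k < n" "x = i * n + k"
      by (rule block_index_cases)
    then show "y \<in> {..<n * m}"
      using x(2) perms_less[OF \<rho>] perms_less[OF \<pi>] by (simp add: block_perm_index block_index_less)
  qed
  have inj: "inj_on (block_perm n m \<pi> \<rho>) {..<n * m}"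
  proof (rule inj_onI)
    fix x y assume xy: "x \<in> {..<n * m}" "y \<in> {..<n * m}" "block_perm n m \<pi> \<rho> x = block_perm n m \<pi> \<rho> y"
    obtain i k where i: "i < m" "k < n" "x = i * n + k"
      using xy(1) by (auto elim: block_index_cases)
    obtain j l where j: "j < m" "l < n" "y = j * n + l"
      using xy(2) by (auto elim: block_index_cases)
    have less: "\<pi> (\<rho> i) k < n" "\<pi> (\<rho> j) l < n"
      using i j perms_less[OF \<rho>] perms_less[OF \<pi>] by auto
    have "\<rho> i * n + \<pi> (\<rho> i) k = \<rho> j * n + \<pi> (\<rho> j) l"
      using xy(3) i j by (simp add: block_perm_index)
    then have eq: "\<rho> i = \<rho> j" "\<pi> (\<rho> i) k = \<pi> (\<rho> j) l"
      using eq_block_iff[OF less(1), of "\<rho> j * n + \<pi> (\<rho> j) l" "\<rho> i"] less by auto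
    have "i = j"
      using eq(1) \<rho> by (simp add: permutes_inj inj_eq)
    moreover have "k = l"
      using eq \<pi>[of "\<rho> j"] perms_less[OF \<rho> j(1)] by (simp add: permutes_inj inj_eq)
    ultimately show "x = y"
      using i j by simp
  qed
  have "bij_betw (block_perm n m \<pi> \<rho>) {..<n * m} {..<n * m}"
    using inj sub by (simp add: bij_betw_def endo_inj_surj)
  then show ?thesis
    by (auto intro!: bij_imp_permutes simp: block_perm_def split: if_splits)
qed

text \<open>Quotient and remainder by \<open>n\<close> recover \<open>\<rho> i\<close> and
  \<open>\<pi> (\<rho> i) k\<close>; surjectivity of \<rho> then reaches every block.\<close>

lemma block_perm_inject:
  assumes "\<And>j. j < m \<Longrightarrow> \<pi> j \<in> perms n" "\<rho> \<in> perms m"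
    and "\<And>j. j < m \<Longrightarrow> \<pi>' j \<in> perms n" "\<rho>' \<in> perms m"
    and "n > 0" and eq: "block_perm n m \<pi> \<rho> = block_perm n m \<pi>' \<rho>'"
  shows "\<rho> = \<rho>'" "\<And>j. j < m \<Longrightarrow> \<pi> j = \<pi>' j"
proof -
  have *: "\<rho> i = \<rho>' i \<and> \<pi> (\<rho> i) k = \<pi>' (\<rho> i) k" if "i < m" "k < n" for i k
  proof -
    have less: "\<pi> (\<rho> i) k < n" "\<pi>' (\<rho>' i) k < n"
      using assms that perms_less by auto
    have "\<rho> i * n + \<pi> (\<rho> i) k = \<rho>' i * n + \<pi>' (\<rho>' i) k"
      using fun_cong[OF eq, of "i * n + k"] that by (simp add: block_perm_index)
    then show ?thesis
      using eq_block_iff[OF less(1), of "\<rho>' i * n + \<pi>' (\<rho>' i) k" "\<rho> i"] less by auto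
  qed
  show "\<rho> = \<rho>'"
  proof
    fix i show "\<rho> i = \<rho>' i"
      using *[of i 0] assms permutes_not_in[of \<rho> "{..<m}" i] permutes_not_in[of \<rho>' "{..<m}" i] by (cases "i < m") auto
  qed
  fix j assume j: "j < m"
  then obtain i where i: "i < m" "\<rho> i = j"
    using permutes_image[of \<rho> "{..<m}"] assms(2) by (metis imageE lessThan_iff mem_Collect_eq)
  show "\<pi> j = \<pi>' j"
  proof
    fix k show "\<pi> j k = \<pi>' j k"
      using *[of i k] i assms(1)[OF j] assms(3)[OF j] permutes_not_in[of "\<pi> j" "{..<n}" k]
        permutes_not_in[of "\<pi>' j" "{..<n}" k] by (cases "k < n") auto
  qed
qed

lemma wreath_perm_mat_iff:
  assumes "\<sigma> \<in> perms (n * m)" "\<And>j. j < m \<Longrightarrow> \<pi> j \<in> perms n" "\<rho> \<in> perms m"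
  shows "perm_mat (n * m) \<sigma> =
      diag_block_mat (map (\<lambda>j. perm_mat n (\<pi> j)) [0..<m]) * kronecker (perm_mat m \<rho>) (1\<^sub>m n)
    \<longleftrightarrow> \<sigma> = block_perm n m \<pi> \<rho>"
proof -
  define f where "f = (\<lambda>x. \<rho> (x div n) * n + x mod n)"
  define g where "g = (\<lambda>x. x div n * n + \<pi> (x div n) (x mod n))"
  have f: "f x < n * m" "g (f x) = block_perm n m \<pi> \<rho> x" if "x < n * m" for x
    using that perms_less[OF assms(3)]
    by (auto elim!: block_index_cases simp: f_def g_def block_perm_index block_index_less)
  have "kronecker (perm_mat m \<rho>) (1\<^sub>m n) = perm_mat (n * m) f"
    using kronecker_perm_mat[of n id m \<rho>] by (simp add: f_def)
  moreover have "diag_block_mat (map (\<lambda>j. perm_mat n (\<pi> j)) [0..<m]) = perm_mat (n * m) g"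
    unfolding g_def using assms(2) perms_less by (intro diag_block_perm_mat) blast
  ultimately have "diag_block_mat (map (\<lambda>j. perm_mat n (\<pi> j)) [0..<m]) * kronecker (perm_mat m \<rho>) (1\<^sub>m n)
      = perm_mat (n * m) (g \<circ> f)"
    using f by (simp add: perm_mat_mult)
  moreover have "perm_mat (n * m) \<sigma> = perm_mat (n * m) (g \<circ> f) \<longleftrightarrow> (\<forall>x<n * m. \<sigma> x = block_perm n m \<pi> \<rho> x)"
    using perms_less[OF assms(1)] f by (subst perm_mat_eq_iff) auto
  moreover have "\<dots> \<longleftrightarrow> \<sigma> = block_perm n m \<pi> \<rho>"
    using assms(1) permutes_not_in[of \<sigma> "{..<n * m}"] by (fastforce simp: block_perm_def fun_eq_iff)
  ultimately show ?thesis
    by simp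
qed

text \<open>The default \<open>id\<close> outside the \<open>m\<close> blocks makes the
  parametrisation injective and matches the product measure \<open>Pi_pmf\<close>.\<close>

lemma wreath_perms_eq:
  "wreath_perms n m = (\<lambda>(\<pi>, \<rho>). block_perm n m \<pi> \<rho>) ` (PiE_dflt {..<m} id (\<lambda>_. perms n) \<times> perms m)"
proof (intro equalityI subsetI)
  fix \<sigma> assume "\<sigma> \<in> wreath_perms n m"
  then obtain \<pi> \<rho> where *: "\<sigma> \<in> perms (n * m)" "\<And>j. j < m \<Longrightarrow> \<pi> j \<in> perms n" "\<rho> \<in> perms m"
    "perm_mat (n * m) \<sigma> =
      diag_block_mat (map (\<lambda>j. perm_mat n (\<pi> j)) [0..<m]) * kronecker (perm_mat m \<rho>) (1\<^sub>m n)"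
    unfolding wreath_perms_def by blast
  define \<pi>' where "\<pi>' = (\<lambda>j. if j < m then \<pi> j else id)"
  have "\<sigma> = block_perm n m \<pi> \<rho>"
    using * wreath_perm_mat_iff by blast
  also have "\<dots> = block_perm n m \<pi>' \<rho>"
    using perms_less[OF *(3)]
    by (auto simp: block_perm_def fun_eq_iff \<pi>'_def less_mult_imp_div_less mult.commute)
  finally show "\<sigma> \<in> (\<lambda>(\<pi>, \<rho>). block_perm n m \<pi> \<rho>) ` (PiE_dflt {..<m} id (\<lambda>_. perms n) \<times> perms m)"
    using *(2,3) by (intro image_eqI[of _ _ "(\<pi>', \<rho>)"]) (auto simp: PiE_dflt_def \<pi>'_def)
next
  fix \<sigma> assume "\<sigma> \<in> (\<lambda>(\<pi>, \<rho>). block_perm n m \<pi> \<rho>) ` (PiE_dflt {..<m} id (\<lambda>_. perms n) \<times> perms m)"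
  then obtain \<pi> \<rho> where *: "\<And>j. j < m \<Longrightarrow> \<pi> j \<in> perms n" "\<rho> \<in> perms m" "\<sigma> = block_perm n m \<pi> \<rho>"
    by (auto simp: PiE_dflt_def)
  then have "\<sigma> \<in> perms (n * m)"
    using block_perm_permutes by blast
  then show "\<sigma> \<in> wreath_perms n m"
    unfolding wreath_perms_def using * wreath_perm_mat_iff[of \<sigma> n m \<pi> \<rho>] by blast
qed

lemma tensor_perms_eq:
  "tensor_perms m n = (\<lambda>(\<pi>, \<rho>). block_perm n m (\<lambda>_. \<pi>) \<rho>) ` (perms n \<times> perms m)"
proof -
  have iff: "perm_mat (n * m) \<sigma> = kronecker (perm_mat m \<rho>) (perm_mat n \<pi>) \<longleftrightarrow> \<sigma> = block_perm n m (\<lambda>_. \<pi>) \<rho>"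
    if "\<sigma> \<in> perms (n * m)" "\<pi> \<in> perms n" "\<rho> \<in> perms m" for \<sigma> \<pi> \<rho>
  proof -
    have "perm_mat (n * m) \<sigma> = kronecker (perm_mat m \<rho>) (perm_mat n \<pi>) \<longleftrightarrow>
        (\<forall>x<n * m. \<sigma> x = block_perm n m (\<lambda>_. \<pi>) \<rho> x)"
      using perms_less[OF that(1)] perms_less[OF that(2)]
      by (subst kronecker_perm_mat) (auto simp: perm_mat_eq_iff block_perm_def)
    also have "\<dots> \<longleftrightarrow> \<sigma> = block_perm n m (\<lambda>_. \<pi>) \<rho>"
      using that(1) permutes_not_in[of \<sigma> "{..<n * m}"] by (fastforce simp: block_perm_def fun_eq_iff)
    finally show ?thesis .
  qed
  have "\<sigma> \<in> tensor_perms m n \<longleftrightarrow> (\<exists>\<pi>\<in>perms n. \<exists>\<rho>\<in>perms m. \<sigma> = block_perm n m (\<lambda>_. \<pi>) \<rho>)" for \<sigma>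
    unfolding tensor_perms_def using iff[of \<sigma>] block_perm_permutes[of m "\<lambda>_. _" n] by blast
  then show ?thesis
    by (auto simp: image_iff)
qed

section \<open>Uniform laws on the wreath and tensor products\<close>

lemma finite_perms [simp]: "finite (perms n)"
  by (rule finite_permutations) simp

lemma perms_nonempty: "perms n \<noteq> {}"
  using permutes_id by blast

lemma pair_pmf_of_set:
  assumes "finite A" "A \<noteq> {}" "finite B" "B \<noteq> {}"
  shows "pair_pmf (pmf_of_set A) (pmf_of_set B) = pmf_of_set (A \<times> B)"
proof (rule pmf_eqI, clarify)
  fix a b show "pmf (pair_pmf (pmf_of_set A) (pmf_of_set B)) (a, b) = pmf (pmf_of_set (A \<times> B)) (a, b)"
    using assms by (simp add: pmf_pair indicator_def)
qed

text \<open>An injective parametrisation by a product set makes the uniform law an image of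
  independent uniform choices.\<close>

lemma pmf_of_wreath_perms:
  assumes "n > 0"
  shows "pmf_of_set (wreath_perms n m) = map_pmf (\<lambda>(\<pi>, \<rho>). block_perm n m \<pi> \<rho>)
    (pair_pmf (Pi_pmf {..<m} id (\<lambda>_. pmf_of_set (perms n))) (pmf_of_set (perms m)))"
proof -
  have inj: "inj_on (\<lambda>(\<pi>, \<rho>). block_perm n m \<pi> \<rho>) (PiE_dflt {..<m} id (\<lambda>_. perms n) \<times> perms m)"
  proof (rule inj_onI, clarify)
    fix \<pi> \<rho> \<pi>' \<rho>'
    assume *: "\<pi> \<in> PiE_dflt {..<m} id (\<lambda>_. perms n)" "\<pi>' \<in> PiE_dflt {..<m} id (\<lambda>_. perms n)"
      "\<rho> permutes {..<m}" "\<rho>' permutes {..<m}" "block_perm n m \<pi> \<rho> = block_perm n m \<pi>' \<rho>'"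
    have mem: "\<pi> j \<in> perms n" "\<pi>' j \<in> perms n" if "j < m" for j
      using *(1,2) that by (auto simp: PiE_dflt_def)
    have "\<rho> = \<rho>'" and eq: "\<And>j. j < m \<Longrightarrow> \<pi> j = \<pi>' j"
      using block_perm_inject[OF mem(1) _ mem(2) _ assms *(5)] *(3,4) by simp_all
    moreover have "\<pi> j = \<pi>' j" for j
      using *(1,2) eq[of j] by (cases "j < m") (auto simp: PiE_dflt_def)
    ultimately show "\<pi> = \<pi>' \<and> \<rho> = \<rho>'"
      by auto
  qed
  let ?A = "PiE_dflt {..<m} id (\<lambda>_. perms n)"
  have A: "finite ?A" "?A \<noteq> {}"
    using perms_nonempty finite_perms by (auto simp only: PiE_dflt_empty_iff intro!: finite_PiE_dflt)
  have "Pi_pmf {..<m} id (\<lambda>_. pmf_of_set (perms n)) = pmf_of_set ?A"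
    by (intro Pi_pmf_of_set finite_perms perms_nonempty) simp
  then show ?thesis
    unfolding wreath_perms_eq
    by (simp only: pair_pmf_of_set[OF A finite_perms perms_nonempty]
        map_pmf_of_set_inj[OF inj] Times_empty A perms_nonempty finite_cartesian_product finite_perms
        de_Morgan_disj not_False_eq_True simp_thms)
qed

lemma pmf_of_tensor_perms:
  assumes "n > 0" "m > 0"
  shows "pmf_of_set (tensor_perms m n) = map_pmf (\<lambda>(\<pi>, \<rho>). block_perm n m (\<lambda>_. \<pi>) \<rho>)
    (pair_pmf (pmf_of_set (perms n)) (pmf_of_set (perms m)))"
proof -
  have "inj_on (\<lambda>(\<pi>, \<rho>). block_perm n m (\<lambda>_. \<pi>) \<rho>) (perms n \<times> perms m)"
    using block_perm_inject[of m "\<lambda>_. _" n _ "\<lambda>_. _"] assms by (auto intro!: inj_onI)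
  then show ?thesis
    unfolding tensor_perms_eq pair_pmf_of_set[OF finite_perms perms_nonempty finite_perms perms_nonempty]
    by (intro map_pmf_of_set_inj[symmetric])
      (auto simp only: finite_cartesian_product finite_perms perms_nonempty Times_empty)
qed

text \<open>Insertion in one-line order visits whole blocks in the order of \<rho>, the form
  required by \<open>height_bst_of_list_blocks\<close>.\<close>

lemma map_block_perm:
  "map (block_perm n m \<pi> \<rho>) [0..<n * m] =
    concat (map (\<lambda>v. map (\<lambda>k. v * n + \<pi> v k) [0..<n]) (map \<rho> [0..<m]))"
proof -
  have "[0..<n * m'] = concat (map (\<lambda>i. map (\<lambda>k. i * n + k) [0..<n]) [0..<m'])" for m'
  proof (induction m')
    case (Suc m')
    have "[0..<n * Suc m'] = [0..<n * m'] @ [n * m'..<n * m' + n]"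
      using upt_add_eq_append[of 0 "n * m'" n] by (simp add: add.commute)
    also have "[n * m'..<n * m' + n] = map (\<lambda>k. m' * n + k) [0..<n]"
      using map_add_upt[of "n * m'" n] by (simp add: mult.commute add.commute)
    finally show ?case
      using Suc by simp
  qed simp
  from this[of m] show ?thesis
    by (auto simp: map_concat block_perm_index o_def intro!: arg_cong[of _ _ concat] map_cong)
qed

lemma map_pmf_one_line_notation:
  "map_pmf (\<lambda>\<pi>. map \<pi> [0..<n]) (pmf_of_set (perms n)) = pmf_of_set (permutations_of_set {0..<n})"
proof (rule map_pmf_of_set_bij_betw)
  let ?f = "\<lambda>\<pi>::nat \<Rightarrow> nat. map \<pi> [0..<n]"
  have inj: "inj_on ?f (perms n)"
  proof (rule inj_onI)
    fix p q assume pq: "p \<in> perms n" "q \<in> perms n" "?f p = ?f q"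
    show "p = q"
    proof
      fix i show "p i = q i"
        using pq permutes_not_in[of p "{..<n}" i] permutes_not_in[of q "{..<n}" i] by (cases "i < n") auto
    qed
  qed
  have "?f ` perms n \<subseteq> permutations_of_set {0..<n}"
    by (auto simp: permutations_of_set_def distinct_map permutes_image permutes_inj_on
        atLeast0LessThan simp flip: image_set)
  \<comment> \<open>Surjectivity by counting: both sides have \<open>n!\<close> elements.\<close>
  moreover have "card (?f ` perms n) = card (permutations_of_set {0..<n})"
    using inj by (simp add: card_image card_permutations[of "{..<n}" n])
  ultimately show "bij_betw ?f (perms n) (permutations_of_set {0..<n})"
    using inj by (simp add: bij_betw_def card_subset_eq)
qed (rule perms_nonempty, rule finite_perms)


subsection \<open>Convergence in distribution\<close>

lemma bst_height_eq:
  assumes "k > 0"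
  shows "real (bst_height k p) = real (height (bst_of_list (map p [0..<k]))) - 1"
proof -
  have "bst_of_list (map p [0..<k]) \<noteq> Leaf"
    using assms by simp
  moreover from this have "height (bst_of_list (map p [0..<k])) > 0"
    by (cases "bst_of_list (map p [0..<k])") auto
  ultimately show ?thesis
    unfolding bst_height_def by (subst edge_height_eq_height) auto
qed

text \<open>\<open>bst_height\<close> counts edges and \<open>height\<close> counts nodes: hence the
  \<open>+ 1\<close> for the big tree, while for \<rho> the edge count is exactly the number of
  spines crossed.\<close>

lemma bst_height_block_perm:
  fixes \<epsilon> L :: real
  assumes "n > 0" "m > 0" and \<rho>: "\<rho> \<in> perms m" and \<pi>: "\<And>v. v < m \<Longrightarrow> \<pi> v \<in> perms n"
    and typical: "\<And>v. v < m \<Longrightarrow> typical_tree \<epsilon> L (bst_of_list (map (\<pi> v) [0..<n]))"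
  shows "real (bst_height (n * m) (block_perm n m \<pi> \<rho>)) + 1 \<in>
    {bst_height m \<rho> * ((1 - \<epsilon>) * L) + (c_star - \<epsilon>) * L..bst_height m \<rho> * ((1 + \<epsilon>) * L) + (c_star + \<epsilon>) * L}"
proof -
  define B where "B = (\<lambda>v. map (\<lambda>k. v * n + \<pi> v k) [0..<n])"
  \<comment> \<open>A shift preserves order, so the block has the same tree shape as its
    permutation.\<close>
  have tree: "bst_of_list (B v) = map_tree ((+) (v * n)) (bst_of_list (map (\<pi> v) [0..<n]))" for v
  proof -
    have "B v = map ((+) (v * n)) (map (\<pi> v) [0..<n])"
      by (simp add: B_def)
    moreover have "strict_mono ((+) (v * n))"
      by (simp add: strict_mono_def)
    ultimately show ?thesis
      by (simp only: bst_of_list_map)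
  qed
  have set: "set (map \<rho> [0..<m]) = {..<m}"
    using \<rho> permutes_image[of \<rho> "{..<m}"] by (simp add: atLeast0LessThan)
  have "real (height (bst_of_list (concat (map B (map \<rho> [0..<m]))))) \<in>
    {(real (height (bst_of_list (map \<rho> [0..<m]))) - 1) * ((1 - \<epsilon>) * L) + (c_star - \<epsilon>) * L..
     (real (height (bst_of_list (map \<rho> [0..<m]))) - 1) * ((1 + \<epsilon>) * L) + (c_star + \<epsilon>) * L}"
  proof (rule height_bst_of_list_blocks)
    show "distinct (map \<rho> [0..<m])"
      using \<rho> by (simp add: distinct_map permutes_inj_on)
    show "map \<rho> [0..<m] \<noteq> []"
      using assms by simp
    fix u assume u: "u \<in> set (map \<rho> [0..<m])"
    then have "u < m"
      unfolding set by simp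
    from typical[OF this] show "real (left_spine (bst_of_list (B u))) \<in> {(1 - \<epsilon>) * L..(1 + \<epsilon>) * L}"
      "real (right_spine (bst_of_list (B u))) \<in> {(1 - \<epsilon>) * L..(1 + \<epsilon>) * L}"
      "real (height (bst_of_list (B u))) \<in> {(c_star - \<epsilon>) * L..(c_star + \<epsilon>) * L}"
      by (simp_all only: tree typical_tree_def left_spine_map_tree right_spine_map_tree height_map_tree)
    show "B u \<noteq> []"
      using assms by (simp add: B_def)
    fix v x y assume v: "v \<in> set (map \<rho> [0..<m])" "u < v" "x \<in> set (B u)" "y \<in> set (B v)"
    then obtain a b where "a < n" "x = u * n + \<pi> u a" "y = v * n + b"
      unfolding B_def by auto
    moreover from this have "\<pi> u a < n"
      using \<pi>[OF \<open>u < m\<close>] perms_less by blast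
    moreover have "u * n + n \<le> v * n"
      using mult_le_mono1[of "Suc u" v n] \<open>u < v\<close> by simp
    ultimately show "x < y"
      by linarith
  qed
  then show ?thesis
    using assms by (simp add: bst_height_eq map_block_perm B_def)
qed

lemma cdf_distr_pmf:
  fixes f :: "'a \<Rightarrow> real"
  shows "cdf (distr (measure_pmf p) borel f) x = measure_pmf.prob p {w. f w \<le> x}"
  by (simp add: cdf_def measure_distr vimage_def)

text \<open>A Slutsky argument by coupling: on \<open>q n\<close> the variable lies close in
  probability to one that already has the limit law.\<close>

lemma weak_conv_m_pmf_close:
  fixes X :: "nat \<Rightarrow> 'a \<Rightarrow> real" and Y :: "nat \<Rightarrow> 'w \<Rightarrow> real" and g :: "'b \<Rightarrow> real"
  assumes p: "eventually (\<lambda>n. p n = map_pmf (\<Phi> n) (q n)) sequentially"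
    and Y: "\<And>n. map_pmf (Y n) (q n) = map_pmf g r"
    and close: "\<And>\<delta>. \<delta> > 0 \<Longrightarrow>
      (\<lambda>n. measure_pmf.prob (q n) {w. \<bar>X n (\<Phi> n w) - Y n w\<bar> > \<delta>}) \<longlonglongrightarrow> 0"
  shows "weak_conv_m (\<lambda>n. distr (measure_pmf (p n)) borel (X n)) (distr (measure_pmf r) borel g)"
  unfolding weak_conv_m_def weak_conv_def
proof (intro allI impI)
  fix x
  define G where "G = cdf (distr (measure_pmf r) borel g)"
  assume "isCont (cdf (distr (measure_pmf r) borel g)) x"
  then have cont: "isCont G x"
    by (simp add: G_def)
  have G: "measure_pmf.prob (q n) {w. Y n w \<le> y} = G y" for n y
  proof -
    have "measure_pmf.prob (map_pmf (Y n) (q n)) {..y} = measure_pmf.prob (map_pmf g r) {..y}"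
      by (simp only: Y)
    then show ?thesis
      by (simp add: G_def cdf_distr_pmf vimage_def)
  qed
  show "(\<lambda>n. cdf (distr (measure_pmf (p n)) borel (X n)) x) \<longlonglongrightarrow> cdf (distr (measure_pmf r) borel g) x"
    unfolding G_def[symmetric]
  proof (rule LIMSEQ_I)
    fix e :: real assume "e > 0"
    then obtain d where d: "d > 0" "\<And>y. \<bar>y - x\<bar> < d \<Longrightarrow> \<bar>G y - G x\<bar> < e / 2"
      using cont[unfolded continuous_at_eps_delta, rule_format, of "e / 2"] by (auto simp: dist_real_def)
    \<comment> \<open>Outside the bad event the distribution function at \<open>x\<close> lies
      between \<open>G (x - \<delta>)\<close> and \<open>G (x + \<delta>)\<close>; continuity at
      \<open>x\<close> closes the gap.\<close>
    define \<delta> where "\<delta> = d / 2"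
    have \<delta>: "\<delta> > 0" "\<bar>G (x + \<delta>) - G x\<bar> < e / 2" "\<bar>G (x - \<delta>) - G x\<bar> < e / 2"
      using d(1) d(2)[of "x + d / 2"] d(2)[of "x - d / 2"] by (simp_all add: \<delta>_def)
    have "eventually (\<lambda>n. measure_pmf.prob (q n) {w. \<bar>X n (\<Phi> n w) - Y n w\<bar> > \<delta>} < e / 2) sequentially"
      using close[OF \<delta>(1)] \<open>e > 0\<close> by (intro order_tendstoD(2)) auto
    with p have "eventually (\<lambda>n. \<bar>cdf (distr (measure_pmf (p n)) borel (X n)) x - G x\<bar> < e) sequentially"
    proof eventually_elim
      case (elim n)
      let ?P = "measure_pmf.prob (q n)"
      let ?D = "{w. \<bar>X n (\<Phi> n w) - Y n w\<bar> > \<delta>}"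
      have F: "cdf (distr (measure_pmf (p n)) borel (X n)) x = ?P {w. X n (\<Phi> n w) \<le> x}"
        by (simp add: elim(1) cdf_distr_pmf vimage_def)
      have "?P {w. X n (\<Phi> n w) \<le> x} \<le> ?P ({w. Y n w \<le> x + \<delta>} \<union> ?D)"
        by (intro measure_pmf.finite_measure_mono) auto
      also have "\<dots> \<le> G (x + \<delta>) + ?P ?D"
        unfolding G[of n, symmetric] by (intro measure_Un_le) auto
      finally have upper: "?P {w. X n (\<Phi> n w) \<le> x} \<le> G (x + \<delta>) + ?P ?D" .
      have "G (x - \<delta>) \<le> ?P ({w. X n (\<Phi> n w) \<le> x} \<union> ?D)"
        unfolding G[of n, symmetric] by (intro measure_pmf.finite_measure_mono) auto
      also have "\<dots> \<le> ?P {w. X n (\<Phi> n w) \<le> x} + ?P ?D"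
        by (intro measure_Un_le) auto
      finally show ?case
        unfolding F using upper elim(2) \<delta> by linarith
    qed
    then show "\<exists>N. \<forall>n\<ge>N. norm (cdf (distr (measure_pmf (p n)) borel (X n)) x - G x) < e"
      by (simp add: eventually_sequentially)
  qed
qed

text \<open>A union bound over a fixed number of blocks, each with the law of
  \<open>random_bst 0 n\<close>.\<close>

lemma atypical_block_prob:
  fixes m :: nat and q :: "nat \<Rightarrow> 'w pmf"
  assumes "0 < \<epsilon>" "\<epsilon> < 1"
    and marginal: "\<And>n v. v < m \<Longrightarrow> map_pmf (\<lambda>w. \<pi> n w v) (q n) = pmf_of_set (perms n)"
  shows "(\<lambda>n. measure_pmf.prob (q n)
    {w. \<exists>v<m. \<not> typical_tree \<epsilon> (ln (real n)) (bst_of_list (map (\<pi> n w v) [0..<n]))}) \<longlonglongrightarrow> 0"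
proof (rule tendsto_sandwich[OF _ _ tendsto_const])
  let ?bad = "\<lambda>n. {t. \<not> typical_tree \<epsilon> (ln (real n)) t}"
  show "eventually (\<lambda>n. measure_pmf.prob (q n)
      {w. \<exists>v<m. \<not> typical_tree \<epsilon> (ln (real n)) (bst_of_list (map (\<pi> n w v) [0..<n]))}
      \<le> m * measure_pmf.prob (random_bst 0 n) (?bad n)) sequentially"
  proof (intro always_eventually allI)
    fix n
    have "measure_pmf.prob (q n) {w. \<exists>v<m. \<not> typical_tree \<epsilon> (ln (real n)) (bst_of_list (map (\<pi> n w v) [0..<n]))}
        = measure_pmf.prob (q n) (\<Union>v<m. {w. bst_of_list (map (\<pi> n w v) [0..<n]) \<in> ?bad n})"
      by (intro arg_cong[of _ _ "measure_pmf.prob (q n)"]) auto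
    also have "\<dots> \<le> (\<Sum>v<m. measure_pmf.prob (q n) {w. bst_of_list (map (\<pi> n w v) [0..<n]) \<in> ?bad n})"
      by (intro measure_pmf.finite_measure_subadditive_finite) auto
    also have "\<dots> = (\<Sum>v<m. measure_pmf.prob (random_bst 0 n) (?bad n))"
    proof (rule sum.cong[OF refl])
      fix v assume v: "v \<in> {..<m}"
      have "random_bst 0 n = map_pmf (\<lambda>w. bst_of_list (map (\<pi> n w v) [0..<n])) (q n)"
        unfolding random_bst_def map_pmf_one_line_notation[symmetric]
        using v by (simp add: map_pmf_comp flip: marginal[of v])
      then show "measure_pmf.prob (q n) {w. bst_of_list (map (\<pi> n w v) [0..<n]) \<in> ?bad n}
          = measure_pmf.prob (random_bst 0 n) (?bad n)"
        by (simp add: vimage_def)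
    qed
    finally show "measure_pmf.prob (q n)
        {w. \<exists>v<m. \<not> typical_tree \<epsilon> (ln (real n)) (bst_of_list (map (\<pi> n w v) [0..<n]))}
        \<le> m * measure_pmf.prob (random_bst 0 n) (?bad n)"
      by simp
  qed
  show "(\<lambda>n. m * measure_pmf.prob (random_bst 0 n) (?bad n)) \<longlonglongrightarrow> 0"
    using tendsto_mult_right_zero[OF random_bst_typical[OF assms(1,2)], of "real m"] by simp
qed simp

text \<open>Only the marginals of the blocks matter, so the blocks may be independent, as in the wreath
  product, or all equal, as in the tensor product.\<close>

lemma block_perm_weak_conv:
  fixes q :: "nat \<Rightarrow> 'w pmf"
  assumes m: "m > 0"
    and p: "\<And>n. n > 0 \<Longrightarrow> p n = map_pmf (\<lambda>w. block_perm n m (\<pi> n w) (\<rho> n w)) (q n)"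
    and \<pi>: "\<And>n v. v < m \<Longrightarrow> map_pmf (\<lambda>w. \<pi> n w v) (q n) = pmf_of_set (perms n)"
    and \<rho>: "\<And>n. map_pmf (\<rho> n) (q n) = pmf_of_set (perms m)"
  shows "weak_conv_m
    (\<lambda>n. distr (measure_pmf (p n)) borel (\<lambda>\<sigma>. real (bst_height (n * m) \<sigma>) / ln (real (n * m))))
    (distr (measure_pmf (pmf_of_set (perms m))) borel (\<lambda>\<rho>. c_star + real (bst_height m \<rho>)))"
proof (rule weak_conv_m_pmf_close)
  show "eventually (\<lambda>n. p n = map_pmf (\<lambda>w. block_perm n m (\<pi> n w) (\<rho> n w)) (q n)) sequentially"
    using eventually_gt_at_top[of 0] by eventually_elim (rule p)
  show "map_pmf (\<lambda>w. c_star + real (bst_height m (\<rho> n w))) (q n) =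
      map_pmf (\<lambda>\<rho>. c_star + real (bst_height m \<rho>)) (pmf_of_set (perms m))" for n
    unfolding \<rho>[of n, symmetric] map_pmf_comp ..
next
  fix \<delta> :: real assume \<delta>: "\<delta> > 0"
  obtain K where K: "\<And>\<rho>. \<rho> \<in> perms m \<Longrightarrow> bst_height m \<rho> \<le> K"
    using finite_imageI[OF finite_perms, of "bst_height m" m] unfolding finite_nat_set_iff_bounded_le by blast
  \<comment> \<open>Each of the at most \<open>K\<close> spines and the final height err by
    \<open>\<epsilon> * ln n\<close>; this choice keeps their sum below half of \<delta> per unit of
    \<open>ln n\<close>.\<close>
  define \<epsilon> where "\<epsilon> = min (1 / 2) (\<delta> / (2 * (K + 1)))"
  have "\<epsilon> * (K + 1) \<le> \<delta> / (2 * (K + 1)) * (K + 1)"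
    by (intro mult_right_mono) (auto simp: \<epsilon>_def)
  also have "\<dots> = \<delta> / 2"
    by (simp add: divide_simps)
  finally have \<epsilon>: "0 < \<epsilon>" "\<epsilon> < 1" "\<epsilon> * (K + 1) \<le> \<delta> / 2"
    using \<delta> by (auto simp: \<epsilon>_def)
  let ?X = "\<lambda>n w. real (bst_height (n * m) (block_perm n m (\<pi> n w) (\<rho> n w))) / ln (real (n * m))"
  let ?Y = "\<lambda>n w. c_star + real (bst_height m (\<rho> n w))"
  let ?bad = "\<lambda>n. {w. \<exists>v<m. \<not> typical_tree \<epsilon> (ln (real n)) (bst_of_list (map (\<pi> n w v) [0..<n]))}"
  show "(\<lambda>n. measure_pmf.prob (q n) {w. \<bar>?X n w - ?Y n w\<bar> > \<delta>}) \<longlonglongrightarrow> 0"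
  proof (rule tendsto_sandwich[OF _ _ tendsto_const])
    show "(\<lambda>n. measure_pmf.prob (q n) (?bad n)) \<longlonglongrightarrow> 0"
      by (rule atypical_block_prob[OF \<epsilon>(1,2) \<pi>])
    \<comment> \<open>The other half of \<delta> pays for the terms without \<open>ln n\<close>: the
      1 between nodes and edges, and the replacement of \<open>ln n\<close> by
      \<open>ln (n * m)\<close>.\<close>
    have "eventually (\<lambda>n. (1 + (c_star + K) * ln (real m)) / ln (real n * real m) < \<delta> / 2) sequentially"
      using m \<delta> by real_asymp
    then show "eventually (\<lambda>n. measure_pmf.prob (q n) {w. \<bar>?X n w - ?Y n w\<bar> > \<delta>}
        \<le> measure_pmf.prob (q n) (?bad n)) sequentially"
      using eventually_gt_at_top[of 1]
    proof eventually_elim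
      case (elim n)
      define L \<Lambda> where "L = ln (real n)" and "\<Lambda> = ln (real (n * m))"
      have L: "L > 0" "\<Lambda> = L + ln (real m)" "ln (real m) \<ge> 0"
        using elim m by (auto simp: L_def \<Lambda>_def ln_mult)
      have "\<bar>?X n w - ?Y n w\<bar> \<le> \<delta>" if w: "w \<in> set_pmf (q n)" "w \<notin> ?bad n" for w
      proof -
        define H where "H = real (bst_height m (\<rho> n w))"
        have "\<rho> n w \<in> set_pmf (pmf_of_set (perms m))"
          unfolding \<rho>[of n, symmetric] using w by simp
        then have \<rho>w: "\<rho> n w \<in> perms m"
          by (simp only: set_pmf_of_set[OF perms_nonempty finite_perms])
        have \<pi>w: "\<pi> n w v \<in> perms n" if "v < m" for v
        proof -
          have "\<pi> n w v \<in> set_pmf (pmf_of_set (perms n))"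
            unfolding \<pi>[OF that, of n, symmetric] using w by simp
          then show ?thesis
            by (simp only: set_pmf_of_set[OF perms_nonempty finite_perms])
        qed
        define h where "h = real (bst_height (n * m) (block_perm n m (\<pi> n w) (\<rho> n w)))"
        have "h + 1 \<in> {H * ((1 - \<epsilon>) * L) + (c_star - \<epsilon>) * L..H * ((1 + \<epsilon>) * L) + (c_star + \<epsilon>) * L}"
          unfolding h_def H_def L_def
          using bst_height_block_perm[where n = n and \<epsilon> = \<epsilon> and L = "ln (real n)", OF _ m \<rho>w \<pi>w] w(2) elim by simp
        then have dev: "\<bar>h + 1 - (c_star + H) * L\<bar> \<le> \<epsilon> * (H + 1) * L"
          by (auto simp: algebra_simps abs_le_iff)
        have H: "0 \<le> H" "H \<le> K"
          using K[OF \<rho>w] by (auto simp: H_def)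
        have "\<bar>h - (c_star + H) * \<Lambda>\<bar> \<le> \<epsilon> * (H + 1) * L + (1 + (c_star + H) * ln (real m))"
        proof -
          have "0 \<le> (c_star + H) * ln (real m)"
            using H L c_star_gt_2 by simp
          then show ?thesis
            using dev unfolding L(2) distrib_left by linarith
        qed
        also have "\<dots> \<le> (\<delta> / 2) * \<Lambda> + (1 + (c_star + K) * ln (real m))"
        proof (intro add_mono mult_mono)
          have "\<epsilon> * (H + 1) \<le> \<epsilon> * (K + 1)"
            using H \<epsilon> by (intro mult_left_mono) auto
          then show "\<epsilon> * (H + 1) \<le> \<delta> / 2"
            using \<epsilon>(3) by linarith
        qed (use H L \<delta> c_star_gt_2 in auto)
        also have "1 + (c_star + K) * ln (real m) \<le> (\<delta> / 2) * \<Lambda>"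
          using elim L by (simp add: \<Lambda>_def field_simps)
        finally have "\<bar>h - (c_star + H) * \<Lambda>\<bar> \<le> \<delta> * \<Lambda>"
          by (simp add: mult.commute)
        moreover have "h / \<Lambda> - (c_star + H) = (h - (c_star + H) * \<Lambda>) / \<Lambda>"
          using L by (simp add: field_simps)
        ultimately have "\<bar>h / \<Lambda> - (c_star + H)\<bar> \<le> \<delta>"
          using L by (simp add: abs_divide pos_divide_le_eq)
        then show ?thesis
          by (simp add: h_def H_def \<Lambda>_def)
      qed
      \<comment> \<open>Only on the support of \<open>q n\<close> are the blocks and \<rho> known to
        be permutations.\<close>
      then have "{w. \<bar>?X n w - ?Y n w\<bar> > \<delta>} \<inter> set_pmf (q n) \<subseteq> ?bad n"
        by (force simp: not_le)
      then have "measure_pmf.prob (q n) ({w. \<bar>?X n w - ?Y n w\<bar> > \<delta>} \<inter> set_pmf (q n))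
          \<le> measure_pmf.prob (q n) (?bad n)"
        by (intro measure_pmf.finite_measure_mono) auto
      then show ?case
        by (simp add: measure_Int_set_pmf)
    qed
  qed simp
qed

theorem theorem2:
  fixes m :: nat
  assumes "m \<ge> 1"
  shows "weak_conv_m
           (\<lambda>n. distr (measure_pmf (pmf_of_set (wreath_perms n m))) borel
              (\<lambda>\<pi>. real (bst_height (n * m) \<pi>) / ln (real (n * m))))
           (distr (measure_pmf (pmf_of_set {\<rho>. \<rho> permutes {..<m}})) borel
              (\<lambda>\<rho>. c_star + real (bst_height m \<rho>)))
       \<and> weak_conv_m
           (\<lambda>n. distr (measure_pmf (pmf_of_set (tensor_perms m n))) borel
              (\<lambda>\<pi>. real (bst_height (n * m) \<pi>) / ln (real (n * m))))
           (distr (measure_pmf (pmf_of_set {\<rho>. \<rho> permutes {..<m}})) borel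
              (\<lambda>\<rho>. c_star + real (bst_height m \<rho>)))"
proof
  have m: "m > 0"
    using assms by simp
  show "weak_conv_m
           (\<lambda>n. distr (measure_pmf (pmf_of_set (wreath_perms n m))) borel
              (\<lambda>\<pi>. real (bst_height (n * m) \<pi>) / ln (real (n * m))))
           (distr (measure_pmf (pmf_of_set {\<rho>. \<rho> permutes {..<m}})) borel
              (\<lambda>\<rho>. c_star + real (bst_height m \<rho>)))"
  proof (rule block_perm_weak_conv[OF m])
    let ?q = "\<lambda>n. pair_pmf (Pi_pmf {..<m} id (\<lambda>_. pmf_of_set (perms n))) (pmf_of_set (perms m))"
    show "pmf_of_set (wreath_perms n m) = map_pmf (\<lambda>w. block_perm n m (fst w) (snd w)) (?q n)" if "n > 0" for n
      using pmf_of_wreath_perms[OF that] by (simp add: case_prod_unfold)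
    show "map_pmf (\<lambda>w. fst w v) (?q n) = pmf_of_set (perms n)" if "v < m" for n v
    proof -
      have "map_pmf (\<lambda>w. fst w v) (?q n) = map_pmf (\<lambda>f. f v) (map_pmf fst (?q n))"
        by (simp only: map_pmf_comp)
      then show ?thesis
        using that by (simp add: map_fst_pair_pmf Pi_pmf_component)
    qed
    show "map_pmf snd (?q n) = pmf_of_set (perms m)" for n
      by (rule map_snd_pair_pmf)
  qed
  show "weak_conv_m
           (\<lambda>n. distr (measure_pmf (pmf_of_set (tensor_perms m n))) borel
              (\<lambda>\<pi>. real (bst_height (n * m) \<pi>) / ln (real (n * m))))
           (distr (measure_pmf (pmf_of_set {\<rho>. \<rho> permutes {..<m}})) borel
              (\<lambda>\<rho>. c_star + real (bst_height m \<rho>)))"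
  proof (rule block_perm_weak_conv[OF m])
    let ?q = "\<lambda>n. pair_pmf (pmf_of_set (perms n)) (pmf_of_set (perms m))"
    show "pmf_of_set (tensor_perms m n) = map_pmf (\<lambda>w. block_perm n m (\<lambda>_. fst w) (snd w)) (?q n)" if "n > 0" for n
      using pmf_of_tensor_perms[OF that m] by (simp add: case_prod_unfold)
    show "map_pmf fst (?q n) = pmf_of_set (perms n)" for n
      by (rule map_fst_pair_pmf)
    show "map_pmf snd (?q n) = pmf_of_set (perms m)" for n
      by (rule map_snd_pair_pmf)
  qed
qed

end
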